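(* Let $\Delta$ be a locally finite semiregular right-angled building over a finite index set $I$ with a fixed legal coloring $\lambda$, and let $\mathbf F=(F_i)_{i\in I}$, $\acute{\mathbf F}=(\acute F_i)_{i\in I}$ be local data with $F_i\leq\acute F_i\leq\widehat F_i\leq\operatorname{Sym}(\Omega_i)$ for every $i\in I$. Endow $\mathcal G(\mathbf F,\acute{\mathbf F})$ with the unique group topology for which the inclusion $\mathcal U(\mathbf F)\hookrightarrow\mathcal G(\mathbf F,\acute{\mathbf F})$ is continuous and open, where $\mathcal U(\mathbf F)$ carries the permutation topology. Then the group $\mathcal G(\mathbf F,\acute{\mathbf F})$ is compactly generated.
   Context: Let $I$ be a finite set and $M=(m_{ij})_{i,j\in I}$ a right-angled Coxeter matrix: $m_{ii}=1$ and $m_{ij}\in\{2,\infty\}$ for $i\neq j$. $\Delta$ is a semiregular right-angled building of type $M$ with parameters $(q_i)_{i\in I}$ (each $i$-panel, i.e. residue of type $\{i\}$, has exactly $q_i$ chambers); it is identified with its set of chambers. Locally finite: all $q_i$ are finite. $\operatorname{Aut}(\Delta)$ is the group of type-preserving automorphisms. The permutation topology on $\operatorname{Aut}(\Delta)$ and its subgroups has as identity neighborhood basis the pointwise stabilizers of finite sets of chambers. Legal coloring: for each $i$ let $\Omega_i$ be a set of cardinality $q_i$; a legal coloring is a map $\lambda=(\lambda_i)_{i\in I}\colon\Delta\to\prod_{i\in I}\Omega_i$ such that for each $i$-panel $\mathcal P$ the restriction $\lambda_i|_{\mathcal P}\colon \mathcal P\to\Omega_i$ is a bijection and $\lambda_j|_{\mathcal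 P}$ is constant for every $j\neq i$. The local action of $g\in\operatorname{Aut}(\Delta)$ at an $i$-panel $\mathcal P$ is $\sigma_\lambda(g,\mathcal P)=\lambda_i|_{g\mathcal P}\circ g|_{\mathcal P}\circ(\lambda_i|_{\mathcal P})^{-1}\in\operatorname{Sym}(\Omega_i)$. Local data $\mathbf F$: a family of permutation groups $F_i\leq\operatorname{Sym}(\Omega_i)$, $i\in I$. $\widehat F_i$ is the Young overgroup of $F_i$: the group of all permutations of $\Omega_i$ stabilizing each $F_i$-orbit. $\mathcal U(\mathbf F)$ is the group of $g\in\operatorname{Aut}(\Delta)$ with $\sigma_\lambda(g,\mathcal P)\in F_i$ for all $i$ and all $i$-panels $\mathcal P$ (similarly $\mathcal U(\acute{\mathbf F})$). $\mathcal G(\mathbf F)$ is the group of $g\in\operatorname{Aut}(\Delta)$ such that for every $i\in I$, $\sigma_\lambda(g,\mathcal P)\in F_i$ for all but finitely many $i$-panels $\mathcal P$. $\mathcal G(\mathbf F,\acute{\mathbf F})=\mathcal G(\mathbf F)\cap\mathcal U(\acute{\mathbf F})$. Topology: a basis of identity neighborhoods for the topology on $\mathcal G(\mathbf F,\acute{\mathbf F})$ is given by the pointwise stabilizers in $\mathcal U(\mathbf F)$ of finite sets of chambers. A topological group is compactly generated if it is generated by a compact subset. *)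

theory Defs
  imports
    "HOL-Library.Extended_Nat"
    "HOL-Analysis.Product_Topology"
    "HOL-Analysis.Abstract_Topology_2"
    "HOL-Algebra.Bij"
    "HOL-Algebra.Group_Action"
    "HOL-Algebra.Generated_Groups"
begin

section \<open>Coxeter groups\<close>

definition coxeter_matrix :: "'i set \<Rightarrow> ('i \<Rightarrow> 'i \<Rightarrow> enat) \<Rightarrow> bool" where
  "coxeter_matrix I m \<longleftrightarrow>
     (\<forall>i\<in>I. m i i = 1) \<and>
     (\<forall>i\<in>I. \<forall>j\<in>I. i \<noteq> j \<longrightarrow> m i j = m j i \<and> 2 \<le> m i j)"

definition right_angled :: "'i set \<Rightarrow> ('i \<Rightarrow> 'i \<Rightarrow> enat) \<Rightarrow> bool" where
  "right_angled I m \<longleftrightarrow>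
     coxeter_matrix I m \<and> (\<forall>i\<in>I. \<forall>j\<in>I. i \<noteq> j \<longrightarrow> m i j = 2 \<or> m i j = \<infinity>)"

text \<open>
  The Coxeter group of type \<open>m\<close> is presented by generators \<open>s\<^sub>i\<close> and relations
  \<open>(s\<^sub>i s\<^sub>j)\<^bsup>m i j\<^esup> = 1\<close> whenever \<open>m i j\<close> is finite. Since \<open>m i i = 1\<close>, every generator is its
  own inverse, so that the group is the quotient of the free monoid of words over \<open>I\<close>
  by the congruence generated by these relations.
\<close>

inductive_set coxeter_congruence :: "'i set \<Rightarrow> ('i \<Rightarrow> 'i \<Rightarrow> enat) \<Rightarrow> ('i list \<times> 'i list) set"
  for I m where
    refl: "w \<in> lists I \<Longrightarrow> (w, w) \<in> coxeter_congruence I m"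
  | rel: "\<lbrakk>u \<in> lists I; v \<in> lists I; i \<in> I; j \<in> I; m i j = enat k\<rbrakk>
      \<Longrightarrow> (u @ concat (replicate k [i, j]) @ v, u @ v) \<in> coxeter_congruence I m"
  | sym: "(u, v) \<in> coxeter_congruence I m \<Longrightarrow> (v, u) \<in> coxeter_congruence I m"
  | trans: "\<lbrakk>(u, v) \<in> coxeter_congruence I m; (v, w) \<in> coxeter_congruence I m\<rbrakk>
      \<Longrightarrow> (u, w) \<in> coxeter_congruence I m"

definition coxeter_group :: "'i set \<Rightarrow> ('i \<Rightarrow> 'i \<Rightarrow> enat) \<Rightarrow> 'i list set set" where
  "coxeter_group I m = lists I // coxeter_congruence I m"

definition word_element :: "'i set \<Rightarrow> ('i \<Rightarrow> 'i \<Rightarrow> enat) \<Rightarrow> 'i list \<Rightarrow> 'i list set" where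
  "word_element I m w = coxeter_congruence I m `` {w}"

definition reduced :: "'i set \<Rightarrow> ('i \<Rightarrow> 'i \<Rightarrow> enat) \<Rightarrow> 'i list \<Rightarrow> bool" where
  "reduced I m w \<longleftrightarrow> w \<in> lists I \<and> (\<forall>v \<in> word_element I m w. length w \<le> length v)"


section \<open>Buildings as chamber systems\<close>

text \<open>
  The chambers are the elements of the type \<open>'c\<close>, and \<open>R i\<close> is the relation of
  \<open>i\<close>-adjacency or equality, whose classes are the \<open>i\<close>-panels. Only the indices
  \<open>i \<in> I\<close> are relevant.
\<close>

definition chamber_system :: "'i set \<Rightarrow> ('i \<Rightarrow> ('c \<times> 'c) set) \<Rightarrow> bool" where
  "chamber_system I R \<longleftrightarrow> (\<forall>i\<in>I. equiv UNIV (R i))"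

definition panels :: "('i \<Rightarrow> ('c \<times> 'c) set) \<Rightarrow> 'i \<Rightarrow> 'c set set" where
  "panels R i = UNIV // R i"

text \<open>\<open>gallery R w c d\<close>: there is a non-stuttering gallery of type \<open>w\<close> from \<open>c\<close> to \<open>d\<close>.\<close>

fun gallery :: "('i \<Rightarrow> ('c \<times> 'c) set) \<Rightarrow> 'i list \<Rightarrow> 'c \<Rightarrow> 'c \<Rightarrow> bool" where
  "gallery R [] c d \<longleftrightarrow> c = d"
| "gallery R (i # w) c d \<longleftrightarrow> (\<exists>e. (c, e) \<in> R i \<and> e \<noteq> c \<and> gallery R w e d)"

definition weyl_distance ::
  "'i set \<Rightarrow> ('i \<Rightarrow> 'i \<Rightarrow> enat) \<Rightarrow> ('i \<Rightarrow> ('c \<times> 'c) set) \<Rightarrow> ('c \<Rightarrow> 'c \<Rightarrow> 'i list set) \<Rightarrow> bool" where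
  "weyl_distance I m R \<delta> \<longleftrightarrow>
     (\<forall>c d. \<delta> c d \<in> coxeter_group I m) \<and>
     (\<forall>c d w. reduced I m w \<longrightarrow> (\<delta> c d = word_element I m w \<longleftrightarrow> gallery R w c d))"

definition building :: "'i set \<Rightarrow> ('i \<Rightarrow> 'i \<Rightarrow> enat) \<Rightarrow> ('i \<Rightarrow> ('c \<times> 'c) set) \<Rightarrow> bool" where
  "building I m R \<longleftrightarrow>
     coxeter_matrix I m \<and> chamber_system I R \<and>
     (\<forall>i\<in>I. \<forall>P\<in>panels R i. \<exists>c\<in>P. \<exists>d\<in>P. c \<noteq> d) \<and>
     (\<exists>\<delta>. weyl_distance I m R \<delta>)"

text \<open>The parameters are natural numbers, so that local finiteness is included.\<close>

definition locally_finite_semiregular ::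
  "'i set \<Rightarrow> ('i \<Rightarrow> ('c \<times> 'c) set) \<Rightarrow> ('i \<Rightarrow> nat) \<Rightarrow> bool" where
  "locally_finite_semiregular I R q \<longleftrightarrow> (\<forall>i\<in>I. \<forall>P\<in>panels R i. finite P \<and> card P = q i)"

definition building_automorphisms :: "'i set \<Rightarrow> ('i \<Rightarrow> ('c \<times> 'c) set) \<Rightarrow> ('c \<Rightarrow> 'c) set" where
  "building_automorphisms I R =
     {g. bij g \<and> (\<forall>i\<in>I. \<forall>c d. (g c, g d) \<in> R i \<longleftrightarrow> (c, d) \<in> R i)}"


section \<open>Colorings and local actions\<close>

definition legal_coloring ::
  "'i set \<Rightarrow> ('i \<Rightarrow> ('c \<times> 'c) set) \<Rightarrow> ('i \<Rightarrow> 'a set) \<Rightarrow> ('i \<Rightarrow> 'c \<Rightarrow> 'a) \<Rightarrow> bool" where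
  "legal_coloring I R \<Omega> lam \<longleftrightarrow>
     (\<forall>i\<in>I. \<forall>P\<in>panels R i.
        bij_betw (lam i) P (\<Omega> i) \<and> (\<forall>j\<in>I - {i}. lam j constant_on P))"

text \<open>
  \<open>Sym(\<Omega> i)\<close> is \<^term>\<open>BijGroup (\<Omega> i)\<close>, whose elements are extensional functions; hence the restriction.
\<close>

definition local_action ::
  "('i \<Rightarrow> 'a set) \<Rightarrow> ('i \<Rightarrow> 'c \<Rightarrow> 'a) \<Rightarrow> 'i \<Rightarrow> ('c \<Rightarrow> 'c) \<Rightarrow> 'c set \<Rightarrow> 'a \<Rightarrow> 'a" where
  "local_action \<Omega> lam i g P = (\<lambda>a\<in>\<Omega> i. lam i (g (inv_into P (lam i) a)))"

definition local_data :: "'i set \<Rightarrow> ('i \<Rightarrow> 'a set) \<Rightarrow> ('i \<Rightarrow> ('a \<Rightarrow> 'a) set) \<Rightarrow> bool" where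
  "local_data I \<Omega> F \<longleftrightarrow> (\<forall>i\<in>I. subgroup (F i) (BijGroup (\<Omega> i)))"

definition young_overgroup :: "'a set \<Rightarrow> ('a \<Rightarrow> 'a) set \<Rightarrow> ('a \<Rightarrow> 'a) set" where
  "young_overgroup S H =
     {p \<in> carrier (BijGroup S).
        \<forall>X \<in> orbits (BijGroup S\<lparr>carrier := H\<rparr>) S (\<lambda>h. h). p ` X = X}"


section \<open>Universal and restricted universal groups\<close>

definition universal_group ::
  "'i set \<Rightarrow> ('i \<Rightarrow> ('c \<times> 'c) set) \<Rightarrow> ('i \<Rightarrow> 'a set) \<Rightarrow> ('i \<Rightarrow> 'c \<Rightarrow> 'a) \<Rightarrow>
   ('i \<Rightarrow> ('a \<Rightarrow> 'a) set) \<Rightarrow> ('c \<Rightarrow> 'c) set" where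
  "universal_group I R \<Omega> lam F =
     {g \<in> building_automorphisms I R. \<forall>i\<in>I. \<forall>P\<in>panels R i. local_action \<Omega> lam i g P \<in> F i}"

definition almost_universal_group ::
  "'i set \<Rightarrow> ('i \<Rightarrow> ('c \<times> 'c) set) \<Rightarrow> ('i \<Rightarrow> 'a set) \<Rightarrow> ('i \<Rightarrow> 'c \<Rightarrow> 'a) \<Rightarrow>
   ('i \<Rightarrow> ('a \<Rightarrow> 'a) set) \<Rightarrow> ('c \<Rightarrow> 'c) set" where
  "almost_universal_group I R \<Omega> lam F =
     {g \<in> building_automorphisms I R.
        \<forall>i\<in>I. finite {P \<in> panels R i. local_action \<Omega> lam i g P \<notin> F i}}"

definition restricted_universal_group ::
  "'i set \<Rightarrow> ('i \<Rightarrow> ('c \<times> 'c) set) \<Rightarrow> ('i \<Rightarrow> 'a set) \<Rightarrow> ('i \<Rightarrow> 'c \<Rightarrow> 'a) \<Rightarrow>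
   ('i \<Rightarrow> ('a \<Rightarrow> 'a) set) \<Rightarrow> ('i \<Rightarrow> ('a \<Rightarrow> 'a) set) \<Rightarrow> ('c \<Rightarrow> 'c) set" where
  "restricted_universal_group I R \<Omega> lam F F' =
     almost_universal_group I R \<Omega> lam F \<inter> universal_group I R \<Omega> lam F'"

definition permutation_group :: "('c \<Rightarrow> 'c) set \<Rightarrow> ('c \<Rightarrow> 'c) monoid" where
  "permutation_group H = BijGroup UNIV\<lparr>carrier := H\<rparr>"


section \<open>Topologies on permutation groups\<close>

definition pointwise_stabilizer :: "('c \<Rightarrow> 'c) set \<Rightarrow> 'c set \<Rightarrow> ('c \<Rightarrow> 'c) set" where
  "pointwise_stabilizer H B = {h \<in> H. \<forall>c\<in>B. h c = c}"

definition permutation_topology :: "('c \<Rightarrow> 'c) set \<Rightarrow> ('c \<Rightarrow> 'c) topology" where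
  "permutation_topology H =
     topology (\<lambda>A. A \<subseteq> H \<and>
       (\<forall>g\<in>A. \<exists>B. finite B \<and> (\<lambda>h. g \<circ> h) ` pointwise_stabilizer H B \<subseteq> A))"

lemma openin_permutation_topology:
  "openin (permutation_topology H) A \<longleftrightarrow>
     A \<subseteq> H \<and> (\<forall>g\<in>A. \<exists>B. finite B \<and> (\<lambda>h. g \<circ> h) ` pointwise_stabilizer H B \<subseteq> A)"
proof -
  let ?P = "\<lambda>A. A \<subseteq> H \<and>
       (\<forall>g\<in>A. \<exists>B. finite B \<and> (\<lambda>h. g \<circ> h) ` pointwise_stabilizer H B \<subseteq> A)"
  have inter: "?P (S \<inter> T)" if S: "?P S" and T: "?P T" for S T
  proof (intro conjI ballI)
    show "S \<inter> T \<subseteq> H" using S by blast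
  next
    fix g assume g: "g \<in> S \<inter> T"
    obtain B where B: "finite B" "(\<lambda>h. g \<circ> h) ` pointwise_stabilizer H B \<subseteq> S"
      using S g by blast
    obtain C where C: "finite C" "(\<lambda>h. g \<circ> h) ` pointwise_stabilizer H C \<subseteq> T"
      using T g by blast
    have "pointwise_stabilizer H (B \<union> C) \<subseteq> pointwise_stabilizer H B \<inter> pointwise_stabilizer H C"
      by (auto simp: pointwise_stabilizer_def)
    then have "(\<lambda>h. g \<circ> h) ` pointwise_stabilizer H (B \<union> C) \<subseteq> S \<inter> T"
      using B(2) C(2) by blast
    with B(1) C(1) show "\<exists>B. finite B \<and> (\<lambda>h. g \<circ> h) ` pointwise_stabilizer H B \<subseteq> S \<inter> T"
      by (intro exI[of _ "B \<union> C"]) simp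
  qed
  have union: "?P (\<Union>K)" if K: "\<forall>A\<in>K. ?P A" for K
  proof (intro conjI ballI)
    show "\<Union>K \<subseteq> H" using K by (simp add: Union_least)
  next
    fix g assume "g \<in> \<Union>K"
    then obtain A where A: "A \<in> K" "g \<in> A" by (rule UnionE)
    have "\<exists>B. finite B \<and> (\<lambda>h. g \<circ> h) ` pointwise_stabilizer H B \<subseteq> A"
      using bspec[OF conjunct2[OF bspec[OF K A(1)]] A(2)] .
    then obtain B where B: "finite B" "(\<lambda>h. g \<circ> h) ` pointwise_stabilizer H B \<subseteq> A"
      by (elim exE conjE)
    show "\<exists>B. finite B \<and> (\<lambda>h. g \<circ> h) ` pointwise_stabilizer H B \<subseteq> \<Union>K"
      using B(1) subset_trans[OF B(2) Union_upper[OF A(1)]] by (intro exI conjI)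
  qed
  have "istopology ?P"
    unfolding istopology_def
  proof (rule conjI)
    show "\<forall>S T. ?P S \<longrightarrow> ?P T \<longrightarrow> ?P (S \<inter> T)"
      by (rule allI, rule allI, rule impI, rule impI, rule inter)
    show "\<forall>K. (\<forall>A\<in>K. ?P A) \<longrightarrow> ?P (\<Union>K)"
      by (rule allI, rule impI, rule union)
  qed
  then show ?thesis
    unfolding permutation_topology_def by (simp only: topology_inverse')
qed

definition topological_group :: "('g, 'b) monoid_scheme \<Rightarrow> 'g topology \<Rightarrow> bool" where
  "topological_group G T \<longleftrightarrow>
     group G \<and> topspace T = carrier G \<and>
     continuous_map (prod_topology T T) T (\<lambda>(x, y). x \<otimes>\<^bsub>G\<^esub> y) \<and>
     continuous_map T T (\<lambda>x. inv\<^bsub>G\<^esub> x)"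

definition compactly_generated :: "('g, 'b) monoid_scheme \<Rightarrow> 'g topology \<Rightarrow> bool" where
  "compactly_generated G T \<longleftrightarrow> (\<exists>K. compactin T K \<and> generate G K = carrier G)"

text \<open>
  The unique group topology on \<open>\<G>(F, F')\<close> for which the inclusion of \<open>\<U>(F)\<close>, with the
  permutation topology, is continuous and open. In general it is finer than the permutation
  topology on \<open>\<G>(F, F')\<close>.
\<close>

definition restricted_universal_topology ::
  "'i set \<Rightarrow> ('i \<Rightarrow> ('c \<times> 'c) set) \<Rightarrow> ('i \<Rightarrow> 'a set) \<Rightarrow> ('i \<Rightarrow> 'c \<Rightarrow> 'a) \<Rightarrow>
   ('i \<Rightarrow> ('a \<Rightarrow> 'a) set) \<Rightarrow> ('i \<Rightarrow> ('a \<Rightarrow> 'a) set) \<Rightarrow> ('c \<Rightarrow> 'c) topology" where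
  "restricted_universal_topology I R \<Omega> lam F F' =
     (THE T. topological_group (permutation_group (restricted_universal_group I R \<Omega> lam F F')) T \<and>
        continuous_map (permutation_topology (universal_group I R \<Omega> lam F)) T (\<lambda>g. g) \<and>
        open_map (permutation_topology (universal_group I R \<Omega> lam F)) T (\<lambda>g. g))"

end

(*
  A legal coloring determines the building up to automorphism: by the word problem in
  right-angled Coxeter groups, a closed colored walk starting at one chamber is closed at
  every other chamber of the same color. Hence color-preserving automorphisms have finitely
  many orbits on chambers, and any other legal coloring is induced by an automorphism.
  Recoloring by permutations that depend only on the color of the projection to a panel P
  yields, for every element s of the Young overgroup, an automorphism ("twist") with local
  action s on the panels parallel to P and local action in F elsewhere.

  Local actions of an automorphism agree on parallel panels. So if g has a bad panel P, where
  its local action s lies outside F, then the panels parallel to P are all bad for g, hence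
  finite in number; the twist at P belongs to the group, and dividing g by it lowers the
  number of bad panels. Up to color-preserving automorphisms there are finitely many twists,
  so finitely many of them generate the group together with U(F), which is in turn generated
  by a compact chamber stabilizer and a finite set because U(F) has finitely many orbits on
  the connected, locally finite building.
*)
theory Submission
  imports Defs
begin

section \<open>Words in right-angled Coxeter groups\<close>

text \<open>What makes a twist possible is the Young overgroup: \<open>s\<close> preserves the
  orbits of \<open>F i\<close>, so for every color \<open>a\<close> some \<open>f a\<close> in
  \<open>F i\<close> agrees with \<open>s\<close> at \<open>a\<close>. A chamber is recolored by
  \<open>f a\<close>, where \<open>a\<close> is the color of its projection. A panel with constant
  projection then sees a single \<open>f a\<close>; on a panel parallel to P each chamber has the
  color of its projection, so the values \<open>f a a = s a\<close> assemble to \<open>s\<close>.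
  The obstacle is that a parallel class may be infinite, and then a twist with \<open>s\<close>
  outside \<open>F i\<close> is not in the group; hence the finitely many twists among the
  generators are chosen by existence and not written down. The topology is given by a definite
  description, so its existence and uniqueness must be settled before compactness makes sense.
  Existence amounts to conjugation being continuous at the identity, which holds because an element
  has finitely many bad panels, each of them a finite set of chambers. The word problem enters
  twice: shortening of walks makes colored walks close up, and the descent criterion yields
  projections to panels.\<close>

definition descent :: "('i \<Rightarrow> 'i \<Rightarrow> enat) \<Rightarrow> 'i list \<Rightarrow> 'i \<Rightarrow> bool" where
  "descent m w i \<longleftrightarrow> (\<exists>u v. w = u @ i # v \<and> (\<forall>k\<in>set v. m i k = 2))"

text \<open>Syntactic counterpart of the deletion condition: the first \<open>i\<close> can be moved
  across \<open>v\<close> and cancelled against the second. Likewise \<open>descent\<close>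
  describes a letter that can be moved to the end of the word.\<close>

definition shortenable :: "('i \<Rightarrow> 'i \<Rightarrow> enat) \<Rightarrow> 'i list \<Rightarrow> bool" where
  "shortenable m w \<longleftrightarrow> (\<exists>u i v z. w = u @ i # v @ i # z \<and> (\<forall>k\<in>set v. m i k = 2))"

text \<open>
  Mozes' numbers game, i.e. the action of the Coxeter group on the dual of its geometric
  representation; the weight 2 is the one belonging to \<open>m i j = \<infinity>\<close>.
\<close>

definition fire :: "('i \<Rightarrow> 'i \<Rightarrow> enat) \<Rightarrow> ('i \<Rightarrow> int) \<Rightarrow> 'i \<Rightarrow> 'i \<Rightarrow> int" where
  "fire m p i = (\<lambda>j. if j = i then - p i else if m i j = 2 then p j else p j + 2 * p i)"

lemma descent_Nil [simp]: "\<not> descent m [] i"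
  by (simp add: descent_def)

lemma descent_snoc:
  "descent m (w @ [i]) j \<longleftrightarrow> i = j \<or> m j i = 2 \<and> descent m w j"
proof
  assume "descent m (w @ [i]) j"
  then obtain u v where uv: "w @ [i] = u @ j # v" "\<forall>k\<in>set v. m j k = 2"
    unfolding descent_def by blast
  show "i = j \<or> m j i = 2 \<and> descent m w j"
  proof (cases v rule: rev_cases)
    case Nil
    then show ?thesis using uv by simp
  next
    case (snoc v' k)
    then have "w = u @ j # v'" "k = i" using uv(1) by simp_all
    then show ?thesis using uv snoc unfolding descent_def by auto
  qed
next
  assume r: "i = j \<or> m j i = 2 \<and> descent m w j"
  show "descent m (w @ [i]) j"
  proof (cases "i = j")
    case True
    then have "w @ [i] = w @ j # []" "\<forall>k\<in>set []. m j k = 2" by simp_all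
    then show ?thesis unfolding descent_def by blast
  next
    case False
    with r obtain u v where "w = u @ j # v" "\<forall>k\<in>set v. m j k = 2" "m j i = 2"
      unfolding descent_def by blast
    then have "w @ [i] = u @ j # (v @ [i])" "\<forall>k\<in>set (v @ [i]). m j k = 2" by auto
    then show ?thesis unfolding descent_def by blast
  qed
qed

lemma shortenable_Nil [simp]: "\<not> shortenable m []"
  by (simp add: shortenable_def)

lemma shortenable_snoc: "shortenable m (w @ [i]) \<longleftrightarrow> shortenable m w \<or> descent m w i"
proof
  assume "shortenable m (w @ [i])"
  then obtain u j v z where uv: "w @ [i] = u @ j # v @ j # z" "\<forall>k\<in>set v. m j k = 2"
    unfolding shortenable_def by blast
  show "shortenable m w \<or> descent m w i"
  proof (cases z rule: rev_cases)
    case Nil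
    then have "w = u @ j # v" "i = j" using uv(1) by simp_all
    then show ?thesis using uv(2) unfolding descent_def by blast
  next
    case (snoc z' k)
    then have "w = u @ j # v @ j # z'" using uv(1) by simp
    then show ?thesis using uv(2) unfolding shortenable_def by blast
  qed
next
  assume "shortenable m w \<or> descent m w i"
  then show "shortenable m (w @ [i])"
  proof
    assume "shortenable m w"
    then obtain u j v z where "w = u @ j # v @ j # z" "\<forall>k\<in>set v. m j k = 2"
      unfolding shortenable_def by blast
    then have "w @ [i] = u @ j # v @ j # (z @ [i])" "\<forall>k\<in>set v. m j k = 2" by simp_all
    then show ?thesis unfolding shortenable_def by blast
  next
    assume "descent m w i"
    then obtain u v where "w = u @ i # v" "\<forall>k\<in>set v. m i k = 2"
      unfolding descent_def by blast
    then have "w @ [i] = u @ i # v @ i # []" "\<forall>k\<in>set v. m i k = 2" by simp_all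
    then show ?thesis unfolding shortenable_def by blast
  qed
qed

lemma shortenable_Cons:
  "shortenable m (i # w) \<longleftrightarrow> shortenable m w \<or> (\<exists>v z. w = v @ i # z \<and> (\<forall>k\<in>set v. m i k = 2))"
proof
  assume "shortenable m (i # w)"
  then obtain u j v z where uv: "i # w = u @ j # v @ j # z" "\<forall>k\<in>set v. m j k = 2"
    unfolding shortenable_def by blast
  then show "shortenable m w \<or> (\<exists>v z. w = v @ i # z \<and> (\<forall>k\<in>set v. m i k = 2))"
    by (cases u) (auto simp: shortenable_def)
next
  assume "shortenable m w \<or> (\<exists>v z. w = v @ i # z \<and> (\<forall>k\<in>set v. m i k = 2))"
  then show "shortenable m (i # w)"
  proof
    assume "shortenable m w"
    then obtain u j v z where "w = u @ j # v @ j # z" "\<forall>k\<in>set v. m j k = 2"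
      unfolding shortenable_def by blast
    then have "i # w = (i # u) @ j # v @ j # z" "\<forall>k\<in>set v. m j k = 2" by simp_all
    then show ?thesis unfolding shortenable_def by blast
  next
    assume "\<exists>v z. w = v @ i # z \<and> (\<forall>k\<in>set v. m i k = 2)"
    then show ?thesis unfolding shortenable_def by (metis append_Nil)
  qed
qed

section \<open>The Coxeter congruence and reduced representatives\<close>

lemma coxeter_congruence_lists:
  "(u, v) \<in> coxeter_congruence I m \<Longrightarrow> u \<in> lists I \<and> v \<in> lists I"
proof (induction rule: coxeter_congruence.induct)
  case (rel u v i j k)
  have "concat (replicate k [i, j]) \<in> lists I" using rel(3,4) by (auto split: if_splits)
  then show ?case using rel by auto
qed auto

lemma coxeter_congruence_context:
  assumes "(u, v) \<in> coxeter_congruence I m" "x \<in> lists I" "y \<in> lists I"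
  shows "(x @ u @ y, x @ v @ y) \<in> coxeter_congruence I m"
  using assms(1)
proof (induction rule: coxeter_congruence.induct)
  case (refl w)
  then show ?case using assms by (intro coxeter_congruence.refl) auto
next
  case (rel u v i j k)
  then have "x @ u \<in> lists I" "v @ y \<in> lists I" using assms by auto
  from coxeter_congruence.rel[of "x @ u" I "v @ y" i j m k, OF this rel(3,4,5)] show ?case by simp
qed (auto intro: coxeter_congruence.sym coxeter_congruence.trans)

lemma equiv_coxeter_congruence: "equiv (lists I) (coxeter_congruence I m)"
proof (rule equivI)
  show "coxeter_congruence I m \<subseteq> lists I \<times> lists I"
  proof (rule subsetI)
    fix p assume "p \<in> coxeter_congruence I m"
    then show "p \<in> lists I \<times> lists I"
      using coxeter_congruence_lists[of "fst p" "snd p" I m] by (cases p) simp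
  qed
  show "refl_on (lists I) (coxeter_congruence I m)"
    by (auto simp: refl_on_def intro: coxeter_congruence.refl dest: coxeter_congruence_lists)
  show "sym_on UNIV (coxeter_congruence I m)"
    by (rule symI) (rule coxeter_congruence.sym)
  show "trans_on UNIV (coxeter_congruence I m)"
    by (rule transI) (rule coxeter_congruence.trans)
qed

lemma word_element_eq_iff:
  assumes "u \<in> lists I" "v \<in> lists I"
  shows "word_element I m u = word_element I m v \<longleftrightarrow> (u, v) \<in> coxeter_congruence I m"
  unfolding word_element_def
  by (rule eq_equiv_class_iff[OF equiv_coxeter_congruence assms])

lemma coxeter_group_representative:
  assumes "X \<in> coxeter_group I m"
  obtains w where "w \<in> lists I" "X = word_element I m w"
  using assms unfolding coxeter_group_def word_element_def by (elim quotientE)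

lemma reduced_iff:
  "reduced I m w \<longleftrightarrow> w \<in> lists I \<and> (\<forall>v. (w, v) \<in> coxeter_congruence I m \<longrightarrow> length w \<le> length v)"
  by (auto simp: reduced_def word_element_def)

lemma reduced_in_lists: "reduced I m w \<Longrightarrow> w \<in> lists I"
  by (simp add: reduced_def)

lemma reduced_length_eq:
  assumes "reduced I m u" "reduced I m v" "(u, v) \<in> coxeter_congruence I m"
  shows "length u = length v"
  using assms coxeter_congruence.sym[OF assms(3)] by (auto simp: reduced_iff intro: le_antisym)

lemma reduced_cong_iff:
  assumes "(u, v) \<in> coxeter_congruence I m" "length u = length v"
  shows "reduced I m u \<longleftrightarrow> reduced I m v"
proof -
  have "(u, x) \<in> coxeter_congruence I m \<longleftrightarrow> (v, x) \<in> coxeter_congruence I m" for x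
    using assms(1) by (blast intro: coxeter_congruence.trans coxeter_congruence.sym)
  then show ?thesis
    using assms(2) coxeter_congruence_lists[OF assms(1)] by (simp add: reduced_iff)
qed

lemma reduced_exists:
  assumes "w \<in> lists I"
  obtains v where "reduced I m v" "(w, v) \<in> coxeter_congruence I m"
proof -
  have "\<exists>v. (w, v) \<in> coxeter_congruence I m"
    using assms by (blast intro: coxeter_congruence.refl)
  then obtain v where v: "(w, v) \<in> coxeter_congruence I m"
    "\<And>u. (w, u) \<in> coxeter_congruence I m \<Longrightarrow> length v \<le> length u"
    using ex_has_least_nat[of "\<lambda>v. (w, v) \<in> coxeter_congruence I m" _ length] by blast
  have "reduced I m v"
    unfolding reduced_iff using v coxeter_congruence_lists[OF v(1)]
    by (blast intro: coxeter_congruence.trans)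
  with v(1) that show thesis by blast
qed

locale right_angled_matrix =
  fixes I :: "'i set" and m :: "'i \<Rightarrow> 'i \<Rightarrow> enat"
  assumes right_angled: "right_angled I m"
begin

abbreviation cong_words (infix "\<doteq>" 50) where
  "u \<doteq> v \<equiv> (u, v) \<in> coxeter_congruence I m"

lemmas cong_sym = coxeter_congruence.sym[of _ _ I m]
  and cong_trans [trans] = coxeter_congruence.trans[of _ _ I m]
  and cong_refl = coxeter_congruence.refl[of _ I m]

lemma m_self: "i \<in> I \<Longrightarrow> m i i = 1"
  using right_angled by (auto simp: right_angled_def coxeter_matrix_def)

lemma m_sym: "i \<in> I \<Longrightarrow> j \<in> I \<Longrightarrow> m i j = m j i"
  using right_angled by (auto simp: right_angled_def coxeter_matrix_def)

lemma commuting_neq: "i \<in> I \<Longrightarrow> m i j = 2 \<Longrightarrow> i \<noteq> j"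
  using m_self by (auto simp: one_enat_def numeral_eq_enat)

lemma m_enat_cases:
  assumes "i \<in> I" "j \<in> I" "m i j = enat k"
  shows "i = j \<and> k = 1 \<or> m i j = 2 \<and> k = 2"
proof (cases "i = j")
  case True
  then show ?thesis using assms m_self[of i] by (simp add: one_enat_def)
next
  case False
  then have "m i j = 2 \<or> m i j = \<infinity>"
    using conjunct2[OF right_angled[unfolded right_angled_def]] assms(1,2) by simp
  with assms(3) have "enat k = enat 2" unfolding numeral_eq_enat by (metis enat.distinct(1))
  then show ?thesis using assms(3) by (simp add: numeral_eq_enat)
qed

lemma cong_append:
  "u \<doteq> v \<Longrightarrow> y \<in> lists I \<Longrightarrow> u @ y \<doteq> v @ y"
  using coxeter_congruence_context[of u v I m "[]" y] by simp

lemma cong_prepend: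
  "u \<doteq> v \<Longrightarrow> x \<in> lists I \<Longrightarrow> x @ u \<doteq> x @ v"
  using coxeter_congruence_context[of u v I m x "[]"] by simp

lemma cong_square: "i \<in> I \<Longrightarrow> [i, i] \<doteq> []"
  using coxeter_congruence.rel[of "[]" I "[]" i i m 1] by (simp add: m_self one_enat_def)

text \<open>Append the trivial word \<open>[j, i, j, i]\<close> to \<open>[i, j]\<close>, then
  cancel \<open>[j, j]\<close> and \<open>[i, i]\<close>.\<close>

lemma cong_swap:
  assumes "i \<in> I" "j \<in> I" "m i j = 2"
  shows "[i, j] \<doteq> [j, i]"
proof -
  have ijij: "[i, j, i, j] \<doteq> []"
    using coxeter_congruence.rel[of "[]" I "[]" i j m 2] assms
    by (simp add: numeral_eq_enat numeral_2_eq_2)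
  have "[i, j] \<doteq> [i, j] @ [j, j]"
    using cong_sym[OF cong_prepend[OF cong_square[of j], of "[i, j]"]] assms by simp
  also have "[i, j] @ [j, j] \<doteq> [i]  @ [j]"
    using coxeter_congruence_context[OF cong_square[of j], of "[i]" "[j]"] assms by simp
  also have "[i] @ [j] \<doteq> [i, j] @ ([j, i] @ [j, i])"
  proof -
    have "[j, i, j, i] \<doteq> []"
      using coxeter_congruence.rel[of "[]" I "[]" j i m 2] assms m_sym[of i j]
      by (simp add: numeral_eq_enat numeral_2_eq_2)
    from cong_sym[OF cong_prepend[OF this, of "[i, j]"]] show ?thesis using assms by simp
  qed
  also have "[i, j] @ ([j, i] @ [j, i]) \<doteq> [i, i, j, i]"
    using coxeter_congruence_context[OF cong_square[of j], of "[i]" "[i, j, i]"] assms by simp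
  also have "[i, i, j, i] \<doteq> [j, i]"
    using cong_append[OF cong_square[of i], of "[j, i]"] assms by simp
  finally show ?thesis .
qed

lemma cong_move:
  assumes "i \<in> I" "v \<in> lists I" "\<forall>k\<in>set v. m i k = 2"
  shows "i # v \<doteq> v @ [i]"
  using assms(2,3)
proof (induction v rule: list.induct)
  case Nil
  then show ?case using assms(1) by (auto intro: cong_refl)
next
  case (Cons k v)
  have k: "k \<in> I" "m i k = 2" and v: "v \<in> lists I" using Cons.prems by auto
  have "[i, k] @ v \<doteq> [k, i] @ v"
    by (rule cong_append[OF cong_swap[OF assms(1) k] v])
  also have "[k, i] @ v \<doteq> [k] @ (v @ [i])"
    using cong_prepend[OF Cons.IH, of "[k]"] Cons.prems by simp
  finally show ?case by simp
qed

lemma cong_delete_pair: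
  assumes "u @ i # v @ i # z \<in> lists I" "\<forall>k\<in>set v. m i k = 2"
  shows "u @ i # v @ i # z \<doteq> u @ v @ z"
proof -
  have "(i # v) @ i # z \<doteq> (v @ [i]) @ i # z"
    using assms by (intro cong_append cong_move) auto
  also have "(v @ [i]) @ i # z \<doteq> v @ z"
    using coxeter_congruence_context[OF cong_square[of i], of v z] assms by auto
  finally show ?thesis
    using cong_prepend[of _ _ u] assms by auto
qed

section \<open>The numbers game and the word problem\<close>

lemma reduced_not_shortenable:
  assumes "reduced I m w"
  shows "\<not> shortenable m w"
proof
  assume "shortenable m w"
  then obtain u i v z where w: "w = u @ i # v @ i # z" "\<forall>k\<in>set v. m i k = 2"
    unfolding shortenable_def by blast
  then have "w \<doteq> u @ v @ z"
    using cong_delete_pair assms by (auto simp: reduced_iff)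
  then have "length w \<le> length (u @ v @ z)"
    using assms unfolding reduced_iff by blast
  then show False using w by simp
qed

text \<open>Firing respects the defining relations, so the final position of the game is an
  invariant of the group element and not of the word. This is what transfers descents from one word
  to another.\<close>

lemma fire_cong:
  "u \<doteq> v \<Longrightarrow> foldl (fire m) p u = foldl (fire m) p v"
proof (induction arbitrary: p rule: coxeter_congruence.induct)
  case (rel u v i j k)
  have "foldl (fire m) p (concat (replicate k [i, j])) = p" for p
    using m_enat_cases[OF rel(3,4,5)]
  proof
    assume "i = j \<and> k = 1"
    then show ?thesis by (auto simp: fire_def)
  next
    assume c: "m i j = 2 \<and> k = 2"
    then show ?thesis
      using m_sym[OF rel(3,4)] commuting_neq[OF rel(3), of j]
      by (auto simp: fire_def numeral_2_eq_2)
  qed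
  then show ?case by simp
qed auto

text \<open>
  The lower bound on \<open>p i + p j\<close> is what keeps a letter that stops being a descent positive.
\<close>

lemma fire_invariant:
  assumes "w \<in> lists I" "\<not> shortenable m w"
  defines "p \<equiv> foldl (fire m) (\<lambda>_. 1) w"
  shows "(\<forall>j\<in>I. if descent m w j then p j < 0 else p j > 0) \<and>
    (\<forall>i\<in>I. \<forall>j\<in>I. i \<noteq> j \<longrightarrow> m i j \<noteq> 2 \<longrightarrow> p i + p j > 0)"
  using assms(1,2) unfolding p_def
proof (induction w rule: rev_induct)
  case Nil
  then show ?case by simp
next
  case (snoc i w)
  let ?p = "foldl (fire m) (\<lambda>_. 1) w" and ?q = "foldl (fire m) (\<lambda>_. 1) (w @ [i])"
  have i: "i \<in> I" and w: "w \<in> lists I" "\<not> shortenable m w" "\<not> descent m w i"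
    using snoc.prems by (auto simp: shortenable_snoc)
  have IH: "\<forall>j\<in>I. if descent m w j then ?p j < 0 else ?p j > 0"
    "\<forall>i\<in>I. \<forall>j\<in>I. i \<noteq> j \<longrightarrow> m i j \<noteq> 2 \<longrightarrow> ?p i + ?p j > 0"
    using snoc.IH[OF w(1,2)] by auto
  have pi: "?p i > 0" using IH(1) i w(3) by auto
  have q: "?q = fire m ?p i" by simp
  show ?case unfolding q
  proof (intro conjI ballI impI)
    fix j assume j: "j \<in> I"
    show "if descent m (w @ [i]) j then fire m ?p i j < 0 else fire m ?p i j > 0"
    proof (cases "j = i")
      case True
      then show ?thesis using pi by (simp add: descent_snoc fire_def)
    next
      case False
      show ?thesis
      proof (cases "m i j = 2")
        case True
        then show ?thesis using False IH(1) j m_sym[OF i j] by (auto simp: descent_snoc fire_def)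
      next
        case nc: False
        then have "?p i + ?p j > 0" using IH(2) i j False by auto
        then show ?thesis using False nc pi m_sym[OF i j] by (auto simp: descent_snoc fire_def)
      qed
    qed
  next
    fix a b assume ab: "a \<in> I" "b \<in> I" "a \<noteq> b" "m a b \<noteq> 2"
    have "?p a + ?p b > 0" using IH(2) ab by auto
    \<comment> \<open>If \<open>a = i\<close> the new sum is \<open>- p a + (p b + 2 * p a)\<close>,
      which equals the old one, and symmetrically for \<open>b = i\<close>; otherwise the sum can
      only grow since \<open>p i > 0\<close>.\<close>
    then show "fire m ?p i a + fire m ?p i b > 0"
      using ab pi m_sym[OF ab(1,2)] by (auto simp: fire_def)
  qed
qed

text \<open>The sign of the final position at \<open>i\<close> tells whether \<open>i\<close> is a
  descent. So the last letter of \<open>w\<close> is a descent of \<open>v\<close> too; cancelling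
  it on both sides leaves a shorter word and a word that is still reduced, and the induction
  applies.\<close>

lemma length_eq_reduced:
  assumes "w \<in> lists I" "\<not> shortenable m w" "w \<doteq> v" "reduced I m v"
  shows "length w = length v"
  using assms
proof (induction w arbitrary: v rule: rev_induct)
  case Nil
  have "v \<doteq> []" by (rule cong_sym[OF Nil.prems(3)])
  moreover have "\<forall>u. v \<doteq> u \<longrightarrow> length v \<le> length u"
    using Nil.prems(4) unfolding reduced_iff by (rule conjunct2)
  ultimately have "length v \<le> length ([] :: 'i list)" by blast
  then show ?case by simp
next
  case (snoc i w)
  have i: "i \<in> I" and w: "w \<in> lists I" "\<not> shortenable m w"
    using snoc.prems by (auto simp: shortenable_snoc)
  have v: "v \<in> lists I" "\<not> shortenable m v"
    using snoc.prems reduced_not_shortenable by (auto simp: reduced_iff)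
  have "foldl (fire m) (\<lambda>_. 1) (w @ [i]) i < 0"
    using conjunct1[OF fire_invariant[OF snoc.prems(1,2)]] i
    by (metis descent_snoc)
  then have "\<not> foldl (fire m) (\<lambda>_. 1) v i > 0"
    using fire_cong[OF snoc.prems(3)] by simp
  then have "descent m v i"
    using conjunct1[OF fire_invariant[OF v]] i by (auto split: if_splits)
  then obtain x y where xy: "v = x @ i # y" "\<forall>k\<in>set y. m i k = 2"
    unfolding descent_def by blast
  have xyI: "x \<in> lists I" "y \<in> lists I" using v xy by auto
  have v_eq: "v \<doteq> x @ y @ [i]"
    using cong_prepend[OF cong_move[OF i xyI(2) xy(2)] xyI(1)] xy by simp
  have "w \<doteq> w @ [i, i]"
    using cong_sym[OF cong_prepend[OF cong_square[OF i] w(1)]] by simp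
  also have "w @ [i, i] \<doteq> v @ [i]"
    using cong_append[OF snoc.prems(3), of "[i]"] i by simp
  also have "v @ [i] \<doteq> x @ y @ [i, i]"
    using cong_append[OF v_eq, of "[i]"] i by simp
  also have "x @ y @ [i, i] \<doteq> x @ y"
    using cong_prepend[OF cong_square[OF i], of "x @ y"] xyI by simp
  finally have wxy: "w \<doteq> x @ y" .
  have "reduced I m (x @ y)"
    unfolding reduced_iff
  proof (intro conjI allI impI)
    fix s assume "x @ y \<doteq> s"
    then have "x @ y @ [i] \<doteq> s @ [i]" using cong_append[of "x @ y" s "[i]"] i by simp
    with v_eq have "v \<doteq> s @ [i]" by (rule cong_trans)
    then have "length v \<le> length (s @ [i])"
      using snoc.prems(4) unfolding reduced_iff by blast
    then show "length (x @ y) \<le> length s" using xy by simp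
  qed (use xyI in auto)
  from snoc.IH[OF w wxy this] show ?case using xy by simp
qed

text \<open>The right-angled case of Tits' solution of the word problem. It turns reducedness, a
  statement about a whole congruence class, into a check on the word itself.\<close>

theorem reduced_iff_not_shortenable:
  "reduced I m w \<longleftrightarrow> w \<in> lists I \<and> \<not> shortenable m w"
proof
  assume "reduced I m w"
  then show "w \<in> lists I \<and> \<not> shortenable m w"
    using reduced_not_shortenable reduced_in_lists by blast
next
  assume w: "w \<in> lists I \<and> \<not> shortenable m w"
  then obtain v where "reduced I m v" "w \<doteq> v" using reduced_exists by blast
  with w show "reduced I m w"
    using reduced_cong_iff[of w v I m] length_eq_reduced[of w v] by simp
qed

end

section \<open>Galleries in right-angled buildings\<close>

text \<open>Unlike a gallery, a walk may stutter. This permits merging two consecutive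
  \<open>i\<close>-steps into one by transitivity without asking whether the result moves.\<close>

fun walk :: "('i \<Rightarrow> ('c \<times> 'c) set) \<Rightarrow> 'i list \<Rightarrow> 'c \<Rightarrow> 'c \<Rightarrow> bool" where
  "walk S [] p q \<longleftrightarrow> p = q"
| "walk S (i # w) p q \<longleftrightarrow> (\<exists>r. (p, r) \<in> S i \<and> walk S w r q)"

lemma walk_append: "walk S (u @ v) p q \<longleftrightarrow> (\<exists>r. walk S u p r \<and> walk S v r q)"
  by (induction u arbitrary: p) auto

lemma gallery_append: "gallery S (u @ v) p q \<longleftrightarrow> (\<exists>r. gallery S u p r \<and> gallery S v r q)"
  by (induction u arbitrary: p) auto

lemma walk_rev:
  assumes "\<And>i. i \<in> I \<Longrightarrow> sym (S i)" "w \<in> lists I" "walk S w p q"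
  shows "walk S (rev w) q p"
  using assms(2,3)
proof (induction w arbitrary: p rule: list.induct)
  case (Cons i w)
  then obtain r where "(p, r) \<in> S i" "walk S w r q" by auto
  then show ?case using Cons assms(1)[of i] by (auto simp: walk_append dest: symD)
qed simp

lemma walk_gallery_or_shorter:
  assumes "walk S w p q"
  shows "gallery S w p q \<or> (\<exists>v. set v \<subseteq> set w \<and> length v < length w \<and> walk S v p q)"
  using assms
proof (induction w arbitrary: p)
  case (Cons i w)
  then obtain r where r: "(p, r) \<in> S i" "walk S w r q" by auto
  show ?case
  proof (cases "r = p")
    case True
    then show ?thesis using r by (intro disjI2 exI[of _ w]) auto
  next
    case False
    show ?thesis using Cons.IH[OF r(2)]
    proof
      assume "gallery S w r q"
      then show ?thesis using r False by auto
    next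
      assume "\<exists>v. set v \<subseteq> set w \<and> length v < length w \<and> walk S v r q"
      then obtain v where "set v \<subseteq> set w" "length v < length w" "walk S v r q" by blast
      then show ?thesis using r by (intro disjI2 exI[of _ "i # v"]) auto
    qed
  qed
qed simp

lemma walk_move:
  assumes "\<And>j p q r. j \<in> set v \<Longrightarrow> (p, q) \<in> S i \<Longrightarrow> (q, r) \<in> S j \<Longrightarrow> \<exists>s. (p, s) \<in> S j \<and> (s, r) \<in> S i"
    and "walk S (i # v) p q"
  shows "walk S (v @ [i]) p q"
  using assms
proof (induction v arbitrary: p)
  case (Cons j v)
  then obtain r t where "(p, r) \<in> S i" "(r, t) \<in> S j" "walk S v t q" by auto
  moreover from this obtain s where s: "(p, s) \<in> S j" "(s, t) \<in> S i"
    using Cons.prems(1)[of j p r t] by auto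
  ultimately have "walk S (v @ [i]) s q"
    using Cons.IH[of s] Cons.prems(1) by auto
  then show ?case using s by auto
qed simp

text \<open>Swaps bring two cancelling letters \<open>i\<close> together, transitivity merges the
  two steps into one, and stutters are dropped; each operation shortens the word. The family
  \<open>S\<close> is abstract because the result is applied to pairs of chambers and not to the
  building itself.\<close>

lemma (in right_angled_matrix) gallery_of_walk:
  assumes trans: "\<And>i. i \<in> I \<Longrightarrow> trans (S i)"
    and swap: "\<And>i j p q r. \<lbrakk>i \<in> I; j \<in> I; m i j = 2; (p, q) \<in> S i; (q, r) \<in> S j\<rbrakk>
        \<Longrightarrow> \<exists>s. (p, s) \<in> S j \<and> (s, r) \<in> S i"
    and "w \<in> lists I" "walk S w p q"
  shows "\<exists>v. reduced I m v \<and> gallery S v p q"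
  using assms(3,4)
proof (induction "length w" arbitrary: w rule: less_induct)
  case less
  show ?case
  proof (cases "shortenable m w")
    case True
    then obtain u i v z where w: "w = u @ i # v @ i # z" "\<forall>k\<in>set v. m i k = 2"
      unfolding shortenable_def by blast
    then obtain a b e where ab: "walk S u p a" "walk S (i # v) a b" "(b, e) \<in> S i" "walk S z e q"
      using less.prems by (auto simp: walk_append)
    have i: "i \<in> I" and vI: "\<And>k. k \<in> set v \<Longrightarrow> k \<in> I" using less.prems w by auto
    have "walk S (v @ [i]) a b"
    proof (rule walk_move[OF _ ab(2)])
      fix j p q r assume "j \<in> set v" "(p, q) \<in> S i" "(q, r) \<in> S j"
      then show "\<exists>s. (p, s) \<in> S j \<and> (s, r) \<in> S i"
        using swap[OF i, of j p q r] vI[of j] w(2) by auto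
    qed
    then obtain b' where b': "walk S v a b'" "(b', b) \<in> S i" by (auto simp: walk_append)
    then have "(b', e) \<in> S i" using trans[OF i] ab(3) by (meson transD)
    then have "walk S (u @ v @ i # z) p q" using ab b' by (auto simp: walk_append)
    then show ?thesis using less.hyps[of "u @ v @ i # z"] less.prems(1) w by auto
  next
    case False
    then have red: "reduced I m w" using less.prems(1) by (simp add: reduced_iff_not_shortenable)
    show ?thesis using walk_gallery_or_shorter[OF less.prems(2)]
    proof
      assume "\<exists>v. set v \<subseteq> set w \<and> length v < length w \<and> walk S v p q"
      then obtain v where v: "set v \<subseteq> set w" "length v < length w" "walk S v p q" by blast
      have "v \<in> lists I" using v(1) less.prems(1) by auto
      then show ?thesis using less.hyps v by blast
    qed (use red in blast)
  qed
qed

locale right_angled_building = right_angled_matrix I m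
  for I :: "'i set" and m :: "'i \<Rightarrow> 'i \<Rightarrow> enat" +
  fixes R :: "'i \<Rightarrow> ('c \<times> 'c) set"
  assumes building: "building I m R"
begin

lemma equiv_R: "i \<in> I \<Longrightarrow> equiv UNIV (R i)"
  using building by (simp add: building_def chamber_system_def)

lemma R_refl: "i \<in> I \<Longrightarrow> (x, x) \<in> R i"
  using equiv_R by (auto simp: equiv_def refl_on_def)

lemma R_sym: "i \<in> I \<Longrightarrow> (x, y) \<in> R i \<Longrightarrow> (y, x) \<in> R i"
  using equiv_R by (meson equiv_def symE)

lemma R_trans: "i \<in> I \<Longrightarrow> (x, y) \<in> R i \<Longrightarrow> (y, z) \<in> R i \<Longrightarrow> (x, z) \<in> R i"
  using equiv_R by (meson equiv_def transE)

lemma panels_iff: "P \<in> panels R i \<longleftrightarrow> (\<exists>x. P = R i `` {x})"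
  by (auto simp: panels_def quotient_def)

lemma panel_in_panels: "R i `` {x} \<in> panels R i"
  by (auto simp: panels_iff)

text \<open>Together with \<open>connected_by_gallery\<close> this extracts from the existentially
  quantified Weyl distance everything the later arguments use.\<close>

lemma gallery_cong_type:
  assumes "gallery R u c d" "reduced I m u" "reduced I m v"
  shows "gallery R v c d \<longleftrightarrow> u \<doteq> v"
proof -
  obtain \<delta> where "weyl_distance I m R \<delta>"
    using building unfolding building_def by blast
  then have "\<delta> c d = word_element I m u" "gallery R v c d \<longleftrightarrow> \<delta> c d = word_element I m v"
    using assms by (simp_all add: weyl_distance_def)
  then show ?thesis
    using word_element_eq_iff[of u I v m] assms(2,3)[THEN reduced_in_lists] by simp
qed

lemma connected_by_gallery: "\<exists>w. reduced I m w \<and> gallery R w c d"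
proof -
  obtain \<delta> where "weyl_distance I m R \<delta>"
    using building unfolding building_def by blast
  then have \<delta>: "\<delta> c d \<in> coxeter_group I m"
    "\<And>w. reduced I m w \<Longrightarrow> \<delta> c d = word_element I m w \<longleftrightarrow> gallery R w c d"
    by (simp_all add: weyl_distance_def)
  obtain u where u: "u \<in> lists I" "\<delta> c d = word_element I m u"
    using coxeter_group_representative[OF \<delta>(1)] by blast
  obtain w where "reduced I m w" "u \<doteq> w" using reduced_exists[OF u(1)] by blast
  then show ?thesis
    using \<delta>(2)[of w] u(2) word_element_eq_iff[OF u(1), of w m] reduced_in_lists[of I m w] by auto
qed

lemma chamber_induct [consumes 0, case_names base step]:
  assumes base: "P c" and step: "\<And>x y i. i \<in> I \<Longrightarrow> P x \<Longrightarrow> (x, y) \<in> R i \<Longrightarrow> P y"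
  shows "P x"
proof -
  have "P y" if "w \<in> lists I" "gallery R w x y" "P x" for w x y
    using that by (induction w arbitrary: x rule: list.induct) (auto intro: step)
  then show ?thesis using connected_by_gallery[of c x] base reduced_in_lists by blast
qed

text \<open>The words \<open>[i, j]\<close> and \<open>[j, i]\<close> are reduced and congruent, so
  a gallery of one type forces a gallery of the other type with the same ends.\<close>

lemma square:
  assumes "i \<in> I" "j \<in> I" "m i j = 2" "(a, b) \<in> R i" "(b, c) \<in> R j"
  shows "\<exists>d. (a, d) \<in> R j \<and> (d, c) \<in> R i"
proof (cases "a = b \<or> b = c")
  case True
  then show ?thesis using assms R_refl by blast
next
  case False
  have "i \<noteq> j" using commuting_neq assms by blast
  then have "reduced I m [i, j]" "reduced I m [j, i]"
    using assms by (auto simp: reduced_iff_not_shortenable shortenable_Cons Cons_eq_append_conv)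
  moreover have "gallery R [i, j] a c" using False assms by auto
  ultimately have "gallery R [j, i] a c"
    using gallery_cong_type cong_swap[OF assms(1-3)] by blast
  then show ?thesis by auto
qed

section \<open>Automorphisms and legal colorings\<close>

lemma legal_coloring_iff:
  "legal_coloring I R \<Omega> lam \<longleftrightarrow>
     (\<forall>i\<in>I. \<forall>x. lam i x \<in> \<Omega> i) \<and>
     (\<forall>i\<in>I. \<forall>x y. (x, y) \<in> R i \<longrightarrow> lam i x = lam i y \<longrightarrow> x = y) \<and>
     (\<forall>i\<in>I. \<forall>x. \<forall>a\<in>\<Omega> i. \<exists>y. (x, y) \<in> R i \<and> lam i y = a) \<and>
     (\<forall>i\<in>I. \<forall>j\<in>I - {i}. \<forall>x y. (x, y) \<in> R i \<longrightarrow> lam j x = lam j y)"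
    (is "?L \<longleftrightarrow> ?R")
proof
  assume L: ?L
  have bij: "bij_betw (lam i) (R i `` {x}) (\<Omega> i)" if "i \<in> I" for i x
    using L that panel_in_panels[of i x] unfolding legal_coloring_def by blast
  have const: "lam j constant_on R i `` {x}" if "i \<in> I" "j \<in> I - {i}" for i j x
    using L that panel_in_panels[of i x] unfolding legal_coloring_def by blast
  show ?R
  proof (intro conjI ballI allI impI)
    fix i x assume i: "i \<in> I"
    show "lam i x \<in> \<Omega> i"
      using bij[OF i, of x] R_refl[OF i, of x] by (auto simp: bij_betw_def)
    fix y assume "(x, y) \<in> R i" "lam i x = lam i y"
    then show "x = y"
      using bij[OF i, of x] R_refl[OF i, of x] by (auto simp: bij_betw_def inj_on_def)
  next
    fix i x a assume i: "i \<in> I" and "a \<in> \<Omega> i"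
    then have "a \<in> lam i ` (R i `` {x})" using bij[OF i, of x] by (simp add: bij_betw_def)
    then show "\<exists>y. (x, y) \<in> R i \<and> lam i y = a" by auto
  next
    fix i j x y assume "i \<in> I" "j \<in> I - {i}" "(x, y) \<in> R i"
    then show "lam j x = lam j y"
      using const[of i j x] R_refl[of i x] unfolding constant_on_def by force
  qed
next
  assume R: ?R
  show ?L
    unfolding legal_coloring_def
  proof (intro ballI conjI)
    fix i P assume i: "i \<in> I" and "P \<in> panels R i"
    then obtain x where P: "P = R i `` {x}" by (auto simp: panels_iff)
    show "bij_betw (lam i) P (\<Omega> i)"
      unfolding bij_betw_def
    proof
      show "inj_on (lam i) P"
      proof (rule inj_onI)
        fix y z assume "y \<in> P" "z \<in> P" and eq: "lam i y = lam i z"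
        then have "(y, z) \<in> R i" using P R_sym[OF i] R_trans[OF i] by blast
        then show "y = z" using R i eq by blast
      qed
      show "lam i ` P = \<Omega> i"
      proof
        show "lam i ` P \<subseteq> \<Omega> i" using R i by blast
        show "\<Omega> i \<subseteq> lam i ` P"
        proof
          fix a assume "a \<in> \<Omega> i"
          then obtain y where "(x, y) \<in> R i" "lam i y = a" using R i by blast
          then show "a \<in> lam i ` P" using P by auto
        qed
      qed
    qed
    fix j assume "j \<in> I - {i}"
    then have "lam j y = lam j x" if "y \<in> P" for y
      using that R i P by (metis Image_singleton_iff)
    then show "lam j constant_on P" by (auto simp: constant_on_def)
  qed
qed

lemma legal_coloring_in: "legal_coloring I R \<Omega> lam \<Longrightarrow> i \<in> I \<Longrightarrow> lam i x \<in> \<Omega> i"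
  by (simp add: legal_coloring_iff)

lemma legal_coloring_inj:
  "legal_coloring I R \<Omega> lam \<Longrightarrow> i \<in> I \<Longrightarrow> (x, y) \<in> R i \<Longrightarrow> lam i x = lam i y \<Longrightarrow> x = y"
  by (simp add: legal_coloring_iff)

lemma legal_coloring_surj:
  "legal_coloring I R \<Omega> lam \<Longrightarrow> i \<in> I \<Longrightarrow> a \<in> \<Omega> i \<Longrightarrow> \<exists>y. (x, y) \<in> R i \<and> lam i y = a"
  by (simp add: legal_coloring_iff)

lemma legal_coloring_const:
  "legal_coloring I R \<Omega> lam \<Longrightarrow> i \<in> I \<Longrightarrow> j \<in> I \<Longrightarrow> j \<noteq> i \<Longrightarrow> (x, y) \<in> R i \<Longrightarrow> lam j x = lam j y"
  by (simp add: legal_coloring_iff)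

section \<open>Automorphisms induced by a change of coloring\<close>

lemma automorphism_iff:
  "g \<in> building_automorphisms I R \<longleftrightarrow> bij g \<and> (\<forall>i\<in>I. \<forall>x y. (g x, g y) \<in> R i \<longleftrightarrow> (x, y) \<in> R i)"
  by (simp add: building_automorphisms_def)

text \<open>The graph \<Gamma> of the morphism consists of all pairs reachable from
  \<open>(c, d)\<close> by walking simultaneously in both coordinates, with equal types and matching
  colors. Surjectivity of colors on panels lets every step of the first coordinate be copied in the
  second; the real issue is that \<Gamma> is single-valued.\<close>

lemma color_morphism_exists:
  assumes lam: "legal_coloring I R \<Omega> lam" and lam': "legal_coloring I R \<Omega> lam'"
    and cd: "\<And>i. i \<in> I \<Longrightarrow> lam i c = lam' i d"
  shows "\<exists>g. g c = d \<and> (\<forall>i\<in>I. \<forall>x. lam' i (g x) = lam i x) \<and>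
    (\<forall>i\<in>I. \<forall>x y. (x, y) \<in> R i \<longrightarrow> (g x, g y) \<in> R i)"
proof -
  define good where "good p \<longleftrightarrow> (\<forall>j\<in>I. lam j (fst p) = lam' j (snd p))" for p :: "'c \<times> 'c"
  define S where "S i = {(p, q). (fst p, fst q) \<in> R i \<and> (snd p, snd q) \<in> R i \<and> good p \<and> good q}" for i
  have sym_S: "sym (S i)" if "i \<in> I" for i
    using R_sym[OF that] by (auto simp: S_def intro!: symI)
  have trans_S: "trans (S i)" if "i \<in> I" for i
  proof (rule transI)
    fix p q r assume "(p, q) \<in> S i" "(q, r) \<in> S i"
    then show "(p, r) \<in> S i"
      using R_trans[OF that, of "fst p" "fst q" "fst r"] R_trans[OF that, of "snd p" "snd q" "snd r"]
      by (simp add: S_def)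
  qed
  have swap_S: "\<exists>s. (p, s) \<in> S j \<and> (s, r) \<in> S i"
    if ij: "i \<in> I" "j \<in> I" "m i j = 2" and S: "(p, q) \<in> S i" "(q, r) \<in> S j" for i j p q r
  proof -
    obtain x where x: "(fst p, x) \<in> R j" "(x, fst r) \<in> R i"
      using square[OF ij, of "fst p" "fst q" "fst r"] S by (auto simp: S_def)
    obtain y where y: "(snd p, y) \<in> R j" "(y, snd r) \<in> R i"
      using square[OF ij, of "snd p" "snd q" "snd r"] S by (auto simp: S_def)
    \<comment> \<open>No index equals both \<open>i\<close> and \<open>j\<close>: for
      \<open>k = i\<close> the match is inherited from \<open>p\<close> along the
      \<open>j\<close>-steps, otherwise from \<open>r\<close> along the
      \<open>i\<close>-steps.\<close>
    have "lam k x = lam' k y" if k: "k \<in> I" for k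
    proof (cases "k = i")
      case True
      then have "k \<noteq> j" using commuting_neq[OF ij(1,3)] by simp
      then have "lam k (fst p) = lam k x" "lam' k (snd p) = lam' k y"
        using legal_coloring_const[OF lam ij(2) k _ x(1)] legal_coloring_const[OF lam' ij(2) k _ y(1)]
        by simp_all
      then show ?thesis using S k by (auto simp: S_def good_def)
    next
      case False
      then have "lam k x = lam k (fst r)" "lam' k y = lam' k (snd r)"
        using legal_coloring_const[OF lam ij(1) k _ x(2)] legal_coloring_const[OF lam' ij(1) k _ y(2)]
        by simp_all
      then show ?thesis using S k by (auto simp: S_def good_def)
    qed
    then have "good (x, y)" by (simp add: good_def)
    then show ?thesis using x y S by (intro exI[of _ "(x, y)"]) (auto simp: S_def)
  qed
  \<comment> \<open>Matching colors exclude a step that moves only the second coordinate: a stutter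
    in the first keeps the \<open>i\<close>-color, hence keeps it in the second, which then stutters
    too.\<close>
  have gallery_fst: "gallery R w (fst p) (fst q)" if "gallery S w p q" "w \<in> lists I" for w p q
    using that
  proof (induction w arbitrary: p)
    case (Cons i w)
    then obtain r where r: "(p, r) \<in> S i" "r \<noteq> p" "gallery S w r q" by auto
    have "fst r \<noteq> fst p"
    proof
      assume eq: "fst r = fst p"
      then have "lam' i (snd p) = lam' i (snd r)" using r(1) Cons.prems by (auto simp: S_def good_def)
      then have "snd p = snd r"
        using legal_coloring_inj[OF lam', of i "snd p" "snd r"] r(1) Cons.prems by (simp add: S_def)
      with eq r(2) show False by (simp add: prod_eq_iff)
    qed
    moreover have "(fst p, fst r) \<in> R i" using r(1) by (simp add: S_def)
    moreover have "gallery R w (fst r) (fst q)" using Cons.IH[OF r(3)] Cons.prems(2) by simp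
    ultimately show ?case by auto
  qed simp
  \<comment> \<open>After shortening in the system of pairs, the first coordinates form a gallery of
    reduced type from \<open>x\<close> to \<open>x\<close>, and only the empty word is such a
    type.\<close>
  have closed: "y = y'" if "w \<in> lists I" "walk S w (x, y) (x, y')" for w x y y'
  proof -
    have "\<exists>v. reduced I m v \<and> gallery S v (x, y) (x, y')"
    proof (rule gallery_of_walk[OF _ _ that])
      show "trans (S i)" if "i \<in> I" for i using trans_S[OF that] .
    qed (rule swap_S)
    then obtain v where v: "reduced I m v" "gallery S v (x, y) (x, y')" by blast
    have "gallery R v x x" using gallery_fst[OF v(2)] reduced_in_lists[OF v(1)] by simp
    moreover have red_Nil: "reduced I m []" by (simp add: reduced_iff)
    ultimately have "[] \<doteq> v" using gallery_cong_type[of "[]" x x v] v(1) by simp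
    then have "v = []" using reduced_length_eq[OF red_Nil v(1)] by simp
    then show ?thesis using v(2) by simp
  qed
  define \<Gamma> where "\<Gamma> x y \<longleftrightarrow> (\<exists>w\<in>lists I. walk S w (c, d) (x, y))" for x y
  have unique: "y = y'" if "\<Gamma> x y" "\<Gamma> x y'" for x y y'
  proof -
    obtain w where w: "w \<in> lists I" "walk S w (c, d) (x, y)"
      using \<open>\<Gamma> x y\<close> unfolding \<Gamma>_def by (elim bexE)
    obtain w' where w': "w' \<in> lists I" "walk S w' (c, d) (x, y')"
      using \<open>\<Gamma> x y'\<close> unfolding \<Gamma>_def by (elim bexE)
    have "walk S (rev w) (x, y) (c, d)" by (rule walk_rev[OF sym_S w])
    with w'(2) have "walk S (rev w @ w') (x, y) (x, y')" by (auto simp: walk_append)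
    moreover have "rev w @ w' \<in> lists I" using w(1) w'(1) by auto
    ultimately show ?thesis using closed[of "rev w @ w'" x y y'] by simp
  qed
  have good_cd: "good (c, d)" using cd by (simp add: good_def)
  have good_walk: "good q" if "walk S w p q" "good p" for w p q
    using that by (induction w arbitrary: p) (auto simp: S_def)
  have good_\<Gamma>: "good (x, y)" if "\<Gamma> x y" for x y
    using that good_walk[OF _ good_cd] unfolding \<Gamma>_def by (elim bexE)
  have \<Gamma>_step: "\<exists>y'. (y, y') \<in> R i \<and> \<Gamma> x' y'" if i: "i \<in> I" and xy: "\<Gamma> x y" and x': "(x, x') \<in> R i" for x y x' i
  proof -
    obtain y' where y': "(y, y') \<in> R i" "lam' i y' = lam i x'"
      using legal_coloring_surj[OF lam' i legal_coloring_in[OF lam i]] by blast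
    have "lam j x' = lam' j y'" if j: "j \<in> I" for j
    proof (cases "j = i")
      case False
      then have "lam j x = lam j x'" "lam' j y = lam' j y'"
        using legal_coloring_const[OF lam i j _ x'] legal_coloring_const[OF lam' i j _ y'(1)]
        by simp_all
      then show ?thesis using good_\<Gamma>[OF xy] j by (simp add: good_def)
    qed (use y' in simp)
    then have "((x, y), (x', y')) \<in> S i"
      using good_\<Gamma>[OF xy] x' y'(1) by (simp add: S_def good_def)
    moreover obtain w where "w \<in> lists I" "walk S w (c, d) (x, y)"
      using xy unfolding \<Gamma>_def by (elim bexE)
    ultimately have "walk S (w @ [i]) (c, d) (x', y')" "w @ [i] \<in> lists I"
      using i by (auto simp: walk_append)
    then have "\<Gamma> x' y'" unfolding \<Gamma>_def by (rule bexI)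
    then show ?thesis using y'(1) by (intro exI conjI)
  qed
  have base: "\<Gamma> c d" unfolding \<Gamma>_def by (rule bexI[of _ "[]"]) simp_all
  have total: "\<exists>y. \<Gamma> x y" for x
  proof (induction x rule: chamber_induct[where c = c])
    case base
    show ?case using \<open>\<Gamma> c d\<close> by blast
  next
    case (step x x' i)
    then obtain y where "\<Gamma> x y" by blast
    then show ?case using \<Gamma>_step[of i x y x'] step by blast
  qed
  define g where "g x = (SOME y. \<Gamma> x y)" for x
  have g: "\<Gamma> x (g x)" for x unfolding g_def by (rule someI_ex[OF total])
  show ?thesis
  proof (intro exI[of _ g] conjI ballI allI impI)
    show "g c = d" using unique[OF g base] .
    show "lam' i (g x) = lam i x" if "i \<in> I" for i x
      using good_\<Gamma>[OF g, of x] that by (simp add: good_def)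
    show "(g x, g y) \<in> R i" if "i \<in> I" "(x, y) \<in> R i" for i x y
      using \<Gamma>_step[OF that(1) g that(2)] unique[OF g] by blast
  qed
qed

text \<open>A chamber adjacent to a fixed one is fixed, because its color determines it within the
  panel. Applied to the composites of two opposite morphisms, this shows that they are mutually
  inverse.\<close>

lemma color_morphism_rigid:
  assumes lam: "legal_coloring I R \<Omega> lam" and "g c = c"
    and col: "\<And>i x. i \<in> I \<Longrightarrow> lam i (g x) = lam i x"
    and hom: "\<And>i x y. i \<in> I \<Longrightarrow> (x, y) \<in> R i \<Longrightarrow> (g x, g y) \<in> R i"
  shows "g x = x"
proof (induction x rule: chamber_induct[where c = c])
  case (step x y i)
  then have "(x, g y) \<in> R i" using hom[of i x y] by simp
  then have "(g y, y) \<in> R i"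
    using R_trans[OF step(1) R_sym[OF step(1)] step(2)] by simp
  then show ?case using legal_coloring_inj[OF lam step(1)] col[OF step(1)] by simp
qed (fact assms(2))

text \<open>The source of all automorphisms that are built from scratch: with equal colorings it
  gives the color-preserving ones, with a recoloring it gives the twists.\<close>

theorem color_automorphism_exists:
  assumes lam: "legal_coloring I R \<Omega> lam" and lam': "legal_coloring I R \<Omega> lam'"
    and cd: "\<And>i. i \<in> I \<Longrightarrow> lam i c = lam' i d"
  shows "\<exists>g\<in>building_automorphisms I R. g c = d \<and> (\<forall>i\<in>I. \<forall>x. lam' i (g x) = lam i x)"
proof -
  obtain g where g: "g c = d" "\<And>i x. i \<in> I \<Longrightarrow> lam' i (g x) = lam i x"
    "\<And>i x y. i \<in> I \<Longrightarrow> (x, y) \<in> R i \<Longrightarrow> (g x, g y) \<in> R i"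
    using color_morphism_exists[OF assms] by blast
  obtain h where h: "h d = c" "\<And>i x. i \<in> I \<Longrightarrow> lam i (h x) = lam' i x"
    "\<And>i x y. i \<in> I \<Longrightarrow> (x, y) \<in> R i \<Longrightarrow> (h x, h y) \<in> R i"
    using color_morphism_exists[OF lam' lam, of d c] cd by auto
  have hg: "h (g x) = x" for x
    using color_morphism_rigid[OF lam, of "\<lambda>x. h (g x)" c x] g h by simp
  have gh: "g (h x) = x" for x
    using color_morphism_rigid[OF lam', of "\<lambda>x. g (h x)" d x] g h by simp
  have "bij g" using hg gh by (intro o_bij[of h]) (auto simp: fun_eq_iff)
  moreover have "(g x, g y) \<in> R i \<longleftrightarrow> (x, y) \<in> R i" if "i \<in> I" for i x y
    using g(3)[OF that] h(3)[OF that, of "g x" "g y"] hg by auto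
  ultimately have "g \<in> building_automorphisms I R" by (simp add: automorphism_iff)
  then show ?thesis using g(1,2) by blast
qed

end

section \<open>Projections to panels\<close>

lemma (in right_angled_matrix) reduced_append:
  assumes "reduced I m (u @ v)"
  shows "reduced I m u" "reduced I m v"
proof -
  have "shortenable m (u @ v)" if "shortenable m u"
    using that unfolding shortenable_def by (metis append.assoc append_Cons)
  moreover have "shortenable m (u @ v)" if "shortenable m v"
    using that unfolding shortenable_def by (metis append.assoc)
  ultimately show "reduced I m u" "reduced I m v"
    using assms by (auto simp: reduced_iff_not_shortenable)
qed

context right_angled_building
begin

lemma reduced_singleton: "i \<in> I \<Longrightarrow> reduced I m [i]"
  by (simp add: reduced_iff_not_shortenable shortenable_Cons)

lemma gallery_snoc: "gallery R (w @ [i]) x c \<longleftrightarrow> (\<exists>d. gallery R w x d \<and> (d, c) \<in> R i \<and> d \<noteq> c)"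
  by (auto simp: gallery_append)

lemma reduced_gallery_length:
  assumes "reduced I m u" "reduced I m v" "gallery R u x c" "gallery R v x c"
  shows "length u = length v"
  using assms gallery_cong_type reduced_length_eq by blast

text \<open>The projection of \<open>x\<close> to the \<open>i\<close>-panel of \<open>c\<close>:
  that \<open>w @ [i]\<close> is reduced means that leaving \<open>c\<close> inside this panel
  increases the distance from \<open>x\<close>.\<close>

definition gate :: "'i \<Rightarrow> 'c \<Rightarrow> 'c \<Rightarrow> bool" where
  "gate i x c \<longleftrightarrow> (\<exists>w. reduced I m (w @ [i]) \<and> gallery R w x c)"

lemma gate_self: "i \<in> I \<Longrightarrow> gate i c c"
  unfolding gate_def using reduced_singleton by (intro exI[of _ "[]"]) simp

text \<open>If \<open>i\<close> is a descent of the distance from \<open>x\<close> to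
  \<open>c\<^sub>0\<close>, move it to the end and stop one step earlier; if not,
  \<open>c\<^sub>0\<close> is itself the gate.\<close>

lemma gate_exists:
  assumes i: "i \<in> I"
  shows "\<exists>c. (c\<^sub>0, c) \<in> R i \<and> gate i x c"
proof -
  obtain w where w: "reduced I m w" "gallery R w x c\<^sub>0" using connected_by_gallery by blast
  show ?thesis
  proof (cases "descent m w i")
    case False
    then have "reduced I m (w @ [i])"
      using w(1) i by (simp add: reduced_iff_not_shortenable shortenable_snoc)
    then show ?thesis using w(2) R_refl[OF i] unfolding gate_def by blast
  next
    case True
    then obtain u v where uv: "w = u @ i # v" "\<forall>k\<in>set v. m i k = 2"
      unfolding descent_def by blast
    have lists: "u \<in> lists I" "v \<in> lists I" using reduced_in_lists[OF w(1)] uv(1) by auto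
    have cong: "w \<doteq> u @ v @ [i]"
      using cong_prepend[OF cong_move[OF i lists(2) uv(2)] lists(1)] uv(1) by simp
    then have red: "reduced I m (u @ v @ [i])"
      using reduced_cong_iff[OF cong] uv(1) w(1) by simp
    then have "gallery R ((u @ v) @ [i]) x c\<^sub>0"
      using gallery_cong_type[OF w(2,1) red] cong by simp
    then obtain c where "gallery R (u @ v) x c" "(c, c\<^sub>0) \<in> R i"
      unfolding gallery_snoc by blast
    then show ?thesis using red R_sym[OF i] unfolding gate_def by (metis append.assoc)
  qed
qed

text \<open>Of two distinct gates in one panel, each would be exactly one step farther from
  \<open>x\<close> than the other.\<close>

lemma gate_unique:
  assumes i: "i \<in> I" and "gate i x c" "gate i x c'" "(c, c') \<in> R i"
  shows "c = c'"
proof (rule ccontr)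
  assume ne: "c \<noteq> c'"
  obtain w where w: "reduced I m (w @ [i])" "gallery R w x c" using assms unfolding gate_def by blast
  obtain w' where w': "reduced I m (w' @ [i])" "gallery R w' x c'"
    using assms unfolding gate_def by blast
  have "gallery R (w @ [i]) x c'" unfolding gallery_snoc using w(2) assms(4) ne by blast
  then have "length (w @ [i]) = length w'"
    using reduced_gallery_length[OF w(1) reduced_append(1)[OF w'(1)]] w'(2) by blast
  moreover have "gallery R (w' @ [i]) x c"
    unfolding gallery_snoc using w'(2) R_sym[OF i assms(4)] ne by blast
  then have "length (w' @ [i]) = length w"
    using reduced_gallery_length[OF w'(1) reduced_append(1)[OF w(1)]] w(2) by blast
  ultimately show False by simp
qed

text \<open>Let \<open>w\<close> lead from \<open>x\<close> to its gate. If
  \<open>j # w @ [i]\<close> is reduced, the distances from \<open>y\<close> to \<open>c\<close> and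
  \<open>c'\<close> contradict \<open>c'\<close> being the gate of \<open>y\<close>. Otherwise the
  prepended \<open>j\<close> cancels against a later letter. If that is the final \<open>i\<close>,
  then \<open>j = i\<close> commutes with all of \<open>w\<close>, which is the claim. If it lies in
  \<open>w\<close>, it can be moved to the front, and \<open>y\<close> would have the same gate as
  \<open>x\<close>.\<close>

lemma gate_adjacent:
  assumes i: "i \<in> I" and j: "j \<in> I" and x: "gate i x c" and y: "gate i y c'"
    and cc: "(c, c') \<in> R i" "c \<noteq> c'" and xy: "(x, y) \<in> R j"
  shows "j = i \<and> (\<exists>w\<in>lists I. (\<forall>k\<in>set w. m i k = 2) \<and> gallery R w x c)"
proof -
  obtain w where w: "reduced I m (w @ [i])" "gallery R w x c" using x unfolding gate_def by blast
  obtain w' where w': "reduced I m (w' @ [i])" "gallery R w' y c'"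
    using y unfolding gate_def by blast
  note rw = reduced_append(1)[OF w(1)] and rw' = reduced_append(1)[OF w'(1)]
  have wI: "w \<in> lists I" using rw by (rule reduced_in_lists)
  have "\<not> gate i y c" using gate_unique[OF i _ y cc(1)] cc(2) by blast
  then have xy': "x \<noteq> y" using x by blast
  show ?thesis
  proof (cases "reduced I m (j # w @ [i])")
    case True
    have "gallery R (j # w) y c" using w(2) R_sym[OF j xy] xy' by auto
    moreover from this have "gallery R ((j # w) @ [i]) y c'"
      unfolding gallery_snoc using cc by blast
    moreover have "reduced I m (j # w)" using reduced_append(1)[of "j # w" "[i]"] True by simp
    moreover have "gallery R (w' @ [i]) y c"
      unfolding gallery_snoc using w'(2) R_sym[OF i cc(1)] cc(2) by blast
    ultimately have "length (j # w) = length (w' @ [i])" "length (j # w @ [i]) = length w'"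
      using reduced_gallery_length w'(1,2) rw' True by (metis append_Cons)+
    then show ?thesis by simp
  next
    case False
    have "shortenable m (j # w @ [i])" "\<not> shortenable m (w @ [i])"
      using False w(1) j by (auto simp: reduced_iff_not_shortenable)
    then obtain v z where vz: "w @ [i] = v @ j # z" "\<forall>k\<in>set v. m j k = 2"
      unfolding shortenable_Cons by blast
    show ?thesis
    proof (cases z rule: rev_cases)
      case Nil
      then have "j = i" "w = v" using vz(1) by auto
      then show ?thesis using vz(2) w(2) wI by blast
    next
      case (snoc z' k)
      then have wv: "w = v @ j # z'" using vz(1) by simp
      have lists: "v \<in> lists I" "z' \<in> lists I" using wI wv by auto
      have "j # v @ z' \<doteq> w"
        using cong_append[OF cong_move[OF j lists(1) vz(2)] lists(2)] wv by simp
      then have cong: "w \<doteq> j # v @ z'" by (rule cong_sym)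
      then have red: "reduced I m (j # v @ z')" using reduced_cong_iff[OF cong] rw wv by simp
      have "[i] \<in> lists I" using i by simp
      from cong_append[OF cong this] have "w @ [i] \<doteq> j # v @ z' @ [i]" by simp
      then have red_i: "reduced I m (j # v @ z' @ [i])" using reduced_cong_iff w(1) wv by fastforce
      have "gallery R (j # v @ z') x c" using gallery_cong_type[OF w(2) rw red] cong by simp
      then obtain x' where x': "(x, x') \<in> R j" "gallery R (v @ z') x' c" by auto
      \<comment> \<open>The gallery now starts with a step inside the \<open>j\<close>-panel of
        \<open>x\<close>, which contains \<open>y\<close>: starting from \<open>y\<close> instead
        either drops this step or replaces it by another \<open>j\<close>-step.\<close>
      have "gate i y c"
      proof (cases "x' = y")
        case True
        have "reduced I m ((v @ z') @ [i])" using reduced_append(2)[of "[j]"] red_i by simp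
        then show ?thesis using x'(2) True unfolding gate_def by blast
      next
        case False
        then have "gallery R (j # v @ z') y c"
          using x' R_trans[OF j R_sym[OF j xy] x'(1)] by auto
        then show ?thesis using red_i unfolding gate_def by (intro exI[of _ "j # v @ z'"]) simp
      qed
      with \<open>\<not> gate i y c\<close> show ?thesis by blast
    qed
  qed
qed

lemma projection_exists:
  assumes i: "i \<in> I"
  obtains \<pi> where
    "\<And>x. (c\<^sub>0, \<pi> x) \<in> R i"
    "\<And>c. (c\<^sub>0, c) \<in> R i \<Longrightarrow> \<pi> c = c"
    "\<And>x y j. \<lbrakk>j \<in> I; (x, y) \<in> R j; \<pi> x \<noteq> \<pi> y\<rbrakk>
      \<Longrightarrow> j = i \<and> (\<exists>w\<in>lists I. (\<forall>k\<in>set w. m i k = 2) \<and> gallery R w x (\<pi> x))"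
proof -
  define \<pi> where "\<pi> x = (SOME c. (c\<^sub>0, c) \<in> R i \<and> gate i x c)" for x
  have \<pi>: "(c\<^sub>0, \<pi> x) \<in> R i \<and> gate i x (\<pi> x)" for x
    unfolding \<pi>_def by (rule someI_ex[OF gate_exists[OF i]])
  have panel: "(c, d) \<in> R i" if "(c\<^sub>0, c) \<in> R i" "(c\<^sub>0, d) \<in> R i" for c d
    using R_trans[OF i R_sym[OF i that(1)] that(2)] .
  show thesis
  proof (rule that)
    show "(c\<^sub>0, \<pi> x) \<in> R i" for x using \<pi> by blast
    show "\<pi> c = c" if "(c\<^sub>0, c) \<in> R i" for c
      using gate_unique[OF i _ gate_self[OF i]] \<pi>[of c] panel that by blast
    show "j = i \<and> (\<exists>w\<in>lists I. (\<forall>k\<in>set w. m i k = 2) \<and> gallery R w x (\<pi> x))"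
      if "j \<in> I" "(x, y) \<in> R j" "\<pi> x \<noteq> \<pi> y" for x y j
      using gate_adjacent[OF i that(1) _ _ _ that(3,2)] \<pi>[of x] \<pi>[of y] panel by blast
  qed
qed

end

section \<open>Local actions\<close>

locale colored_building = right_angled_building I m R
  for I :: "'i set" and m :: "'i \<Rightarrow> 'i \<Rightarrow> enat" and R :: "'i \<Rightarrow> ('c \<times> 'c) set" +
  fixes \<Omega> :: "'i \<Rightarrow> 'a set" and lam :: "'i \<Rightarrow> 'c \<Rightarrow> 'a"
  assumes legal: "legal_coloring I R \<Omega> lam"
begin

abbreviation "Aut \<equiv> building_automorphisms I R"
abbreviation "loc \<equiv> local_action \<Omega> lam"

lemmas lam_in = legal_coloring_in[OF legal]
  and lam_inj = legal_coloring_inj[OF legal]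
  and lam_surj = legal_coloring_surj[OF legal]
  and lam_const = legal_coloring_const[OF legal]

lemma local_action_apply:
  assumes i: "i \<in> I" and "(x, y) \<in> R i"
  shows "loc i g (R i `` {x}) (lam i y) = lam i (g y)"
proof -
  have "inj_on (lam i) (R i `` {x})"
    using legal panel_in_panels i unfolding legal_coloring_def bij_betw_def by blast
  then show ?thesis using assms lam_in[OF i] by (simp add: local_action_def)
qed

lemma local_action_eqI:
  assumes i: "i \<in> I" and f: "f \<in> extensional (\<Omega> i)"
    and "\<And>y. (x, y) \<in> R i \<Longrightarrow> lam i (g y) = f (lam i y)"
  shows "loc i g (R i `` {x}) = f"
proof
  fix a
  show "loc i g (R i `` {x}) a = f a"
  proof (cases "a \<in> \<Omega> i")
    case True
    then obtain y where y: "(x, y) \<in> R i" "lam i y = a" using lam_surj[OF i] by blast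
    then show ?thesis using local_action_apply[OF i y(1), of g] assms(3) by simp
  next
    case False
    then show ?thesis using f by (simp add: local_action_def extensional_def)
  qed
qed

lemma Aut_R: "g \<in> Aut \<Longrightarrow> i \<in> I \<Longrightarrow> (g x, g y) \<in> R i \<longleftrightarrow> (x, y) \<in> R i"
  by (simp add: automorphism_iff)

lemma Aut_bij: "g \<in> Aut \<Longrightarrow> bij g"
  by (simp add: automorphism_iff)

lemma Aut_id: "id \<in> Aut"
  by (simp add: automorphism_iff)

lemma Aut_comp: "g \<in> Aut \<Longrightarrow> h \<in> Aut \<Longrightarrow> g \<circ> h \<in> Aut"
  by (simp add: automorphism_iff bij_comp)

lemma Aut_inv: "g \<in> Aut \<Longrightarrow> inv_into UNIV g \<in> Aut"
  unfolding automorphism_iff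
  by (metis bij_imp_bij_inv bij_inv_eq_iff)

lemma Aut_image_panel:
  assumes "g \<in> Aut" "i \<in> I"
  shows "g ` (R i `` {x}) = R i `` {g x}"
proof
  show "g ` (R i `` {x}) \<subseteq> R i `` {g x}" using Aut_R[OF assms] by auto
  show "R i `` {g x} \<subseteq> g ` (R i `` {x})"
  proof
    fix y assume "y \<in> R i `` {g x}"
    moreover obtain z where "y = g z" using Aut_bij[OF assms(1)] by (metis bij_pointE)
    ultimately show "y \<in> g ` (R i `` {x})" using Aut_R[OF assms] by auto
  qed
qed

lemma Aut_panels: "g \<in> Aut \<Longrightarrow> i \<in> I \<Longrightarrow> P \<in> panels R i \<Longrightarrow> g ` P \<in> panels R i"
  using Aut_image_panel by (auto simp: panels_iff)

lemma local_action_Bij: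
  assumes g: "g \<in> Aut" and i: "i \<in> I" and "P \<in> panels R i"
  shows "loc i g P \<in> Bij (\<Omega> i)"
proof -
  obtain x where P: "P = R i `` {x}" using assms(3) panels_iff by blast
  let ?f = "loc i g P"
  have app: "?f (lam i y) = lam i (g y)" if "(x, y) \<in> R i" for y
    using local_action_apply[OF i that] P by simp
  have "bij_betw ?f (\<Omega> i) (\<Omega> i)"
    unfolding bij_betw_def
  proof
    show "inj_on ?f (\<Omega> i)"
    proof (rule inj_onI)
      fix a b assume "a \<in> \<Omega> i" "b \<in> \<Omega> i" and eq: "?f a = ?f b"
      then obtain y z where yz: "(x, y) \<in> R i" "lam i y = a" "(x, z) \<in> R i" "lam i z = b"
        using lam_surj[OF i] by metis
      then have "(g y, g z) \<in> R i"
        using R_trans[OF i R_sym[OF i]] Aut_R[OF g i] by blast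
      then have "g y = g z" using lam_inj[OF i] app yz eq by metis
      then show "a = b" using yz Aut_bij[OF g] by (metis bij_is_inj injD)
    qed
    show "?f ` \<Omega> i = \<Omega> i"
    proof
      show "?f ` \<Omega> i \<subseteq> \<Omega> i" using app lam_in[OF i] lam_surj[OF i, of _ x] by force
      show "\<Omega> i \<subseteq> ?f ` \<Omega> i"
      proof
        fix a assume "a \<in> \<Omega> i"
        then obtain y where y: "(g x, y) \<in> R i" "lam i y = a" using lam_surj[OF i] by blast
        moreover obtain z where "y = g z" using Aut_bij[OF g] by (metis bij_pointE)
        ultimately show "a \<in> ?f ` \<Omega> i"
          using app[of z] Aut_R[OF g i] lam_in[OF i, of z] by (metis imageI)
      qed
    qed
  qed
  then show ?thesis by (simp add: Bij_def local_action_def)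
qed

lemma local_action_comp:
  assumes g: "g \<in> Aut" and h: "h \<in> Aut" and i: "i \<in> I" and "P \<in> panels R i"
  shows "loc i (g \<circ> h) P = loc i g (h ` P) \<otimes>\<^bsub>BijGroup (\<Omega> i)\<^esub> loc i h P"
proof -
  obtain x where P: "P = R i `` {x}" using assms(4) panels_iff by blast
  have hP: "h ` P = R i `` {h x}" using Aut_image_panel[OF h i] P by simp
  have "loc i (g \<circ> h) (R i `` {x}) = compose (\<Omega> i) (loc i g (h ` P)) (loc i h P)"
  proof (rule local_action_eqI[OF i compose_extensional])
    fix y assume y: "(x, y) \<in> R i"
    then have "(h x, h y) \<in> R i" using Aut_R[OF h i] by simp
    then have "loc i g (h ` P) (lam i (h y)) = lam i (g (h y))"
      unfolding hP by (rule local_action_apply[OF i])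
    moreover have "loc i h P (lam i y) = lam i (h y)"
      unfolding P by (rule local_action_apply[OF i y])
    ultimately show "lam i ((g \<circ> h) y) = compose (\<Omega> i) (loc i g (h ` P)) (loc i h P) (lam i y)"
      using lam_in[OF i] by (simp add: compose_def)
  qed
  then show ?thesis
    using local_action_Bij[OF g i Aut_panels[OF h i assms(4)]] local_action_Bij[OF h i assms(4)] P
    by (simp add: BijGroup_def)
qed

lemma local_action_trivial:
  assumes "i \<in> I" "P \<in> panels R i" "\<And>x. x \<in> P \<Longrightarrow> lam i (g x) = lam i x"
  shows "loc i g P = \<one>\<^bsub>BijGroup (\<Omega> i)\<^esub>"
proof -
  obtain x where P: "P = R i `` {x}" using assms(2) panels_iff by blast
  have "loc i g (R i `` {x}) = (\<lambda>a\<in>\<Omega> i. a)"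
    using assms(3) P lam_in[OF assms(1)] by (intro local_action_eqI[OF assms(1)]) auto
  then show ?thesis by (simp add: P BijGroup_def)
qed

lemma local_action_inv:
  assumes g: "g \<in> Aut" and i: "i \<in> I" and P: "P \<in> panels R i"
  shows "loc i (inv_into UNIV g) (g ` P) = inv\<^bsub>BijGroup (\<Omega> i)\<^esub> loc i g P"
proof -
  interpret group "BijGroup (\<Omega> i)" by (rule group_BijGroup)
  have "inv_into UNIV g \<circ> g = id" using Aut_bij[OF g] by (simp add: bij_is_inj)
  then have "loc i (inv_into UNIV g) (g ` P) \<otimes>\<^bsub>BijGroup (\<Omega> i)\<^esub> loc i g P = \<one>\<^bsub>BijGroup (\<Omega> i)\<^esub>"
    using local_action_comp[OF Aut_inv[OF g] g i P] local_action_trivial[OF i P, of id] by simp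
  moreover have "loc i g P \<in> carrier (BijGroup (\<Omega> i))"
    "loc i (inv_into UNIV g) (g ` P) \<in> carrier (BijGroup (\<Omega> i))"
    using local_action_Bij[OF g i P] local_action_Bij[OF Aut_inv[OF g] i Aut_panels[OF g i P]]
    by (simp_all add: BijGroup_def)
  ultimately show ?thesis by (metis inv_equality)
qed

lemma gallery_color_const:
  assumes "i \<in> I" "w \<in> lists I" "\<forall>k\<in>set w. m i k = 2" "gallery R w x c"
  shows "lam i x = lam i c"
  using assms(2-4)
proof (induction w arbitrary: x rule: list.induct)
  case (Cons k w)
  then obtain y where "(x, y) \<in> R k" "gallery R w y c" by auto
  then show ?case
    using lam_const[of k i x y] commuting_neq[of i k] Cons assms(1) by auto
qed simp

text \<open>It is enough to cross one \<open>k\<close>-adjacency with \<open>k\<close> commuting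
  with \<open>i\<close>. The square pushes the \<open>i\<close>-panel across, and neither the
  \<open>k\<close>-steps nor their images under \<open>g\<close> change the
  \<open>i\<close>-color.\<close>

lemma local_action_parallel:
  assumes g: "g \<in> Aut" and i: "i \<in> I"
    and "w \<in> lists I" "\<forall>k\<in>set w. m i k = 2" "gallery R w x c"
  shows "loc i g (R i `` {x}) = loc i g (R i `` {c})"
  using assms(3-5)
proof (induction w arbitrary: x rule: list.induct)
  case (Cons k w)
  then obtain y where y: "(x, y) \<in> R k" "gallery R w y c" by auto
  have k: "k \<in> I" "m i k = 2" "i \<noteq> k" using Cons.prems commuting_neq[OF i] by auto
  have "loc i g (R i `` {x}) = loc i g (R i `` {y})"
  proof (rule local_action_eqI[OF i])
    fix z assume "(x, z) \<in> R i"
    then obtain d where d: "(z, d) \<in> R k" "(d, y) \<in> R i"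
      using square[OF i k(1,2) R_sym[OF i] y(1)] by blast
    have "lam i (g z) = lam i (g d)" "lam i z = lam i d"
      using lam_const[OF k(1) i k(3)] d(1) Aut_R[OF g k(1)] by auto
    then show "lam i (g z) = loc i g (R i `` {y}) (lam i z)"
      using local_action_apply[OF i R_sym[OF i d(2)]] by simp
  qed (simp add: local_action_def)
  then show ?case using Cons y by auto
qed simp

text \<open>
  Off the panels parallel to that of \<open>c\<^sub>0\<close> the projection is constant on every panel, so a
  recoloring by a permutation depending only on the color of the projection is again legal.
\<close>

lemma recoloring_automorphism:
  assumes i: "i \<in> I" and \<sigma>: "\<sigma> \<in> Bij (\<Omega> i)"
    and f: "\<And>a. a \<in> \<Omega> i \<Longrightarrow> f a \<in> Bij (\<Omega> i)" "\<And>a. a \<in> \<Omega> i \<Longrightarrow> f a a = \<sigma> a"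
  shows "\<exists>h\<in>Aut. loc i h (R i `` {c\<^sub>0}) = \<sigma> \<and>
    (\<forall>j\<in>I - {i}. \<forall>P\<in>panels R j. loc j h P = \<one>\<^bsub>BijGroup (\<Omega> j)\<^esub>) \<and>
    (\<forall>P\<in>panels R i. (\<exists>a\<in>\<Omega> i. loc i h P = f a) \<or>
      loc i h P = \<sigma> \<and> (\<forall>g\<in>Aut. loc i g P = loc i g (R i `` {c\<^sub>0})))"
proof -
  obtain \<pi> where \<pi>: "\<And>x. (c\<^sub>0, \<pi> x) \<in> R i" "\<And>c. (c\<^sub>0, c) \<in> R i \<Longrightarrow> \<pi> c = c"
    "\<And>x y j. \<lbrakk>j \<in> I; (x, y) \<in> R j; \<pi> x \<noteq> \<pi> y\<rbrakk>
      \<Longrightarrow> j = i \<and> (\<exists>w\<in>lists I. (\<forall>k\<in>set w. m i k = 2) \<and> gallery R w x (\<pi> x))"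
    using projection_exists[OF i, of c\<^sub>0] by blast
  \<comment> \<open>Where \<pi> is constant with color \<open>a\<close>, the recoloring is the
    single permutation \<open>f a\<close>; where \<pi> preserves the \<open>i\<close>-color, it is
    \<open>f a a = \<sigma> a\<close> at each color \<open>a\<close>.\<close>
  define lam' where "lam' j x = (if j = i then f (lam i (\<pi> x)) (lam i x) else lam j x)" for j x
  have parallel: "lam i (\<pi> y) = lam i y \<and> (\<forall>g\<in>Aut. loc i g (R i `` {y}) = loc i g (R i `` {c\<^sub>0}))"
    if xy: "(x, y) \<in> R i" and z: "(x, z) \<in> R i" "\<pi> z \<noteq> \<pi> x" for x y z
  proof -
    \<comment> \<open>Since \<pi> separates \<open>x\<close> from \<open>z\<close>, at least one of
      the two serves as \<open>y'\<close>, whatever \<open>y\<close> is. Thus every chamber of the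
      panel is joined to its projection by a gallery commuting with \<open>i\<close>.\<close>
    obtain y' where "(y, y') \<in> R i" "\<pi> y \<noteq> \<pi> y'"
      using xy z R_sym[OF i] R_trans[OF i] by metis
    then obtain w where w: "w \<in> lists I" "\<forall>k\<in>set w. m i k = 2" "gallery R w y (\<pi> y)"
      using \<pi>(3)[OF i] by blast
    have "R i `` {\<pi> y} = R i `` {c\<^sub>0}" using equiv_class_eq[OF equiv_R[OF i] \<pi>(1)] by simp
    then show ?thesis
      using gallery_color_const[OF i w] local_action_parallel[OF _ i w] by simp
  qed
  have dich: "(\<forall>y. (x, y) \<in> R i \<longrightarrow> \<pi> y = \<pi> x) \<or>
      (\<forall>y. (x, y) \<in> R i \<longrightarrow> lam i (\<pi> y) = lam i y) \<and>
      (\<forall>g\<in>Aut. loc i g (R i `` {x}) = loc i g (R i `` {c\<^sub>0}))" for x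
    using parallel R_refl[OF i] by blast
  have lam'_panel: "(\<exists>a\<in>\<Omega> i. \<forall>y. (x, y) \<in> R i \<longrightarrow> lam' i y = f a (lam i y)) \<or>
      (\<forall>y. (x, y) \<in> R i \<longrightarrow> lam' i y = \<sigma> (lam i y)) \<and>
      (\<forall>g\<in>Aut. loc i g (R i `` {x}) = loc i g (R i `` {c\<^sub>0}))" for x
    using dich[of x]
  proof
    assume "\<forall>y. (x, y) \<in> R i \<longrightarrow> \<pi> y = \<pi> x"
    then have "\<forall>y. (x, y) \<in> R i \<longrightarrow> lam' i y = f (lam i (\<pi> x)) (lam i y)" by (simp add: lam'_def)
    then show ?thesis using lam_in[OF i] by blast
  next
    assume a: "(\<forall>y. (x, y) \<in> R i \<longrightarrow> lam i (\<pi> y) = lam i y) \<and>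
      (\<forall>g\<in>Aut. loc i g (R i `` {x}) = loc i g (R i `` {c\<^sub>0}))"
    then have "\<forall>y. (x, y) \<in> R i \<longrightarrow> lam' i y = \<sigma> (lam i y)"
      using f(2) lam_in[OF i] by (simp add: lam'_def)
    with a show ?thesis by blast
  qed
  have panel_perm: "\<exists>p\<in>Bij (\<Omega> i). \<forall>y. (x, y) \<in> R i \<longrightarrow> lam' i y = p (lam i y)" for x
    using lam'_panel[of x] f(1) \<sigma> by blast
  have legal': "legal_coloring I R \<Omega> lam'"
    unfolding legal_coloring_iff
  proof (intro conjI ballI allI impI)
    fix j x assume j: "j \<in> I"
    show "lam' j x \<in> \<Omega> j"
    proof (cases "j = i")
      case True
      obtain p where "p \<in> Bij (\<Omega> i)" "lam' i x = p (lam i x)"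
        using panel_perm R_refl[OF i] by blast
      then show ?thesis using True lam_in[OF i, of x] Bij_imp_funcset by fastforce
    qed (use lam_in j in \<open>simp add: lam'_def\<close>)
    fix y assume xy: "(x, y) \<in> R j" and eq: "lam' j x = lam' j y"
    show "x = y"
    proof (cases "j = i")
      case True
      obtain p where p: "p \<in> Bij (\<Omega> i)" "lam' i x = p (lam i x)" "lam' i y = p (lam i y)"
        using panel_perm R_refl[OF i] xy True by blast
      then have "lam i x = lam i y"
        using eq True lam_in[OF i] by (auto simp: Bij_def bij_betw_def inj_on_def)
      then show ?thesis using lam_inj[OF i] xy True by blast
    qed (use lam_inj[OF j] xy eq in \<open>simp add: lam'_def\<close>)
  next
    fix j x a assume j: "j \<in> I" and a: "a \<in> \<Omega> j"
    show "\<exists>y. (x, y) \<in> R j \<and> lam' j y = a"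
    proof (cases "j = i")
      case True
      obtain p where p: "p \<in> Bij (\<Omega> i)" "\<forall>y. (x, y) \<in> R i \<longrightarrow> lam' i y = p (lam i y)"
        using panel_perm by blast
      have "a \<in> p ` \<Omega> i" using p(1) a True by (simp add: Bij_def bij_betw_def)
      then obtain b where "b \<in> \<Omega> i" "p b = a" by blast
      then show ?thesis using lam_surj[OF i] p(2) True by metis
    qed (use lam_surj[OF j a] in \<open>simp add: lam'_def\<close>)
  next
    fix j k x y assume j: "j \<in> I" and k: "k \<in> I - {j}" and xy: "(x, y) \<in> R j"
    have "lam k x = lam k y" using lam_const[OF j] k xy by blast
    moreover have "k = i \<Longrightarrow> \<pi> x = \<pi> y" using \<pi>(3)[OF j xy] k by blast
    ultimately show "lam' k x = lam' k y" by (cases "k = i") (simp_all add: lam'_def)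
  qed
  have lam'_c: "lam' i y = \<sigma> (lam i y)" if "(c\<^sub>0, y) \<in> R i" for y
    using \<pi>(2)[OF that] f(2) lam_in[OF i] by (simp add: lam'_def)
  \<comment> \<open>Only the \<open>i\<close>-color was changed, so a chamber with the
    \<open>lam'\<close>-colors of \<open>c\<^sub>0\<close> is found in the \<open>i\<close>-panel of
    \<open>c\<^sub>0\<close>.\<close>
  obtain d where d: "(c\<^sub>0, d) \<in> R i" "lam i d = lam' i c\<^sub>0"
    using lam_surj[OF i] legal_coloring_in[OF legal' i] by blast
  have "lam' j c\<^sub>0 = lam j d" if "j \<in> I" for j
    using d lam_const[OF i that] by (cases "j = i") (auto simp: lam'_def)
  \<comment> \<open>With \<open>lam'\<close> as source and \<open>lam\<close> as target coloring,
    \<open>lam j (h x) = lam' j x\<close>, so the local actions of \<open>h\<close> with respect to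
    \<open>lam\<close> can be read off from the recoloring.\<close>
  then obtain h where h: "h \<in> Aut" "\<And>j x. j \<in> I \<Longrightarrow> lam j (h x) = lam' j x"
    using color_automorphism_exists[OF legal' legal] by blast
  have ext: "\<sigma> \<in> extensional (\<Omega> i)" "\<And>a. a \<in> \<Omega> i \<Longrightarrow> f a \<in> extensional (\<Omega> i)"
    using \<sigma> f(1) by (auto simp: Bij_def)
  show ?thesis
  proof (intro bexI[OF _ h(1)] conjI ballI)
    show "loc i h (R i `` {c\<^sub>0}) = \<sigma>"
      using lam'_c h(2)[OF i] by (intro local_action_eqI[OF i ext(1)]) simp
    show "loc j h P = \<one>\<^bsub>BijGroup (\<Omega> j)\<^esub>" if "j \<in> I - {i}" "P \<in> panels R j" for j P
      using that h(2) by (intro local_action_trivial) (auto simp: lam'_def)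
    fix P assume "P \<in> panels R i"
    then obtain x where P: "P = R i `` {x}" using panels_iff by blast
    show "(\<exists>a\<in>\<Omega> i. loc i h P = f a) \<or>
        loc i h P = \<sigma> \<and> (\<forall>g\<in>Aut. loc i g P = loc i g (R i `` {c\<^sub>0}))"
      using lam'_panel[of x]
    proof
      assume "\<exists>a\<in>\<Omega> i. \<forall>y. (x, y) \<in> R i \<longrightarrow> lam' i y = f a (lam i y)"
      then obtain a where a: "a \<in> \<Omega> i" "\<forall>y. (x, y) \<in> R i \<longrightarrow> lam' i y = f a (lam i y)" by blast
      have "loc i h P = f a"
        unfolding P using a h(2)[OF i] by (intro local_action_eqI[OF i ext(2)]) auto
      then show ?thesis using a(1) by blast
    next
      assume a: "(\<forall>y. (x, y) \<in> R i \<longrightarrow> lam' i y = \<sigma> (lam i y)) \<and>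
        (\<forall>g\<in>Aut. loc i g (R i `` {x}) = loc i g (R i `` {c\<^sub>0}))"
      then have "loc i h P = \<sigma>"
        unfolding P using h(2)[OF i] by (intro local_action_eqI[OF i ext(1)]) auto
      with a show ?thesis unfolding P by blast
    qed
  qed
qed

end

section \<open>Permutation groups and their topology\<close>

locale permutations =
  fixes G :: "('c \<Rightarrow> 'c) set"
  assumes bij: "g \<in> G \<Longrightarrow> bij g"
    and id_closed: "id \<in> G"
    and comp_closed: "g \<in> G \<Longrightarrow> h \<in> G \<Longrightarrow> g \<circ> h \<in> G"
    and inv_closed: "g \<in> G \<Longrightarrow> inv_into UNIV g \<in> G"
begin

lemma inv_comp: "g \<in> G \<Longrightarrow> inv_into UNIV g \<circ> g = id"
  using bij by (simp add: bij_is_inj)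

lemma comp_inv: "g \<in> G \<Longrightarrow> g \<circ> inv_into UNIV g = id"
  using bij by (simp add: fun_eq_iff bij_is_surj surj_f_inv_f)

lemma carrier_permutation_group [simp]: "carrier (permutation_group G) = G"
  by (simp add: permutation_group_def)

lemma mult_permutation_group [simp]:
  "g \<in> G \<Longrightarrow> h \<in> G \<Longrightarrow> g \<otimes>\<^bsub>permutation_group G\<^esub> h = g \<circ> h"
  using bij by (simp add: permutation_group_def BijGroup_def Bij_def compose_def comp_def restrict_def)

lemma one_permutation_group [simp]: "\<one>\<^bsub>permutation_group G\<^esub> = id"
  by (simp add: permutation_group_def BijGroup_def id_def restrict_def)

lemma group_permutation_group: "group (permutation_group G)"
proof (rule groupI)
  show "\<exists>h\<in>carrier (permutation_group G). h \<otimes>\<^bsub>permutation_group G\<^esub> g = \<one>\<^bsub>permutation_group G\<^esub>"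
    if "g \<in> carrier (permutation_group G)" for g
    using that inv_closed inv_comp by (intro bexI[of _ "inv_into UNIV g"]) simp_all
qed (simp_all add: id_closed comp_closed comp_assoc)

lemma inv_permutation_group [simp]:
  "g \<in> G \<Longrightarrow> inv\<^bsub>permutation_group G\<^esub> g = inv_into UNIV g"
  using group.inv_equality[OF group_permutation_group, of "inv_into UNIV g" g]
  by (simp add: inv_comp inv_closed)

lemma inv_into_comp:
  "g \<in> G \<Longrightarrow> h \<in> G \<Longrightarrow> inv_into UNIV (g \<circ> h) = inv_into UNIV h \<circ> inv_into UNIV g"
  using bij by (simp add: o_inv_distrib)

lemma pointwise_stabilizer_permutations: "permutations (pointwise_stabilizer G B)"
proof unfold_locales
  fix g assume g: "g \<in> pointwise_stabilizer G B"
  then show "bij g" by (simp add: pointwise_stabilizer_def bij)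
  show "inv_into UNIV g \<in> pointwise_stabilizer G B"
    using g bij[of g] inv_closed[of g]
    by (auto simp: pointwise_stabilizer_def bij_is_inj inv_f_eq)
qed (auto simp: pointwise_stabilizer_def id_closed comp_closed)

lemma topspace_permutation_topology: "topspace (permutation_topology G) = G"
proof
  show "topspace (permutation_topology G) \<subseteq> G"
    using openin_topspace[of "permutation_topology G"] unfolding openin_permutation_topology by blast
  have "openin (permutation_topology G) G"
    unfolding openin_permutation_topology using comp_closed
    by (auto simp: pointwise_stabilizer_def intro!: exI[of _ "{}"])
  then show "G \<subseteq> topspace (permutation_topology G)" by (rule openin_subset)
qed

end

text \<open>For \<open>G = U\<close> this is \<open>permutation_topology U\<close>. Separating the
  ambient set from the group that supplies the neighborhoods makes \<open>U\<close> open in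
  \<open>G\<close> for \<open>U \<subseteq> G\<close>.\<close>

definition coset_topology :: "('c \<Rightarrow> 'c) set \<Rightarrow> ('c \<Rightarrow> 'c) set \<Rightarrow> ('c \<Rightarrow> 'c) topology" where
  "coset_topology G U = topology (\<lambda>A. A \<subseteq> G \<and>
     (\<forall>g\<in>A. \<exists>B. finite B \<and> (\<lambda>h. g \<circ> h) ` pointwise_stabilizer U B \<subseteq> A))"

lemma openin_coset_topology:
  "openin (coset_topology G U) A \<longleftrightarrow>
     A \<subseteq> G \<and> (\<forall>g\<in>A. \<exists>B. finite B \<and> (\<lambda>h. g \<circ> h) ` pointwise_stabilizer U B \<subseteq> A)"
proof -
  let ?N = "\<lambda>A g. \<exists>B. finite B \<and> (\<lambda>h. g \<circ> h) ` pointwise_stabilizer U B \<subseteq> A"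
  have "istopology (\<lambda>A. A \<subseteq> G \<and> (\<forall>g\<in>A. ?N A g))"
    unfolding istopology_def
  proof (intro conjI allI impI)
    fix S T assume S: "S \<subseteq> G \<and> (\<forall>g\<in>S. ?N S g)" and T: "T \<subseteq> G \<and> (\<forall>g\<in>T. ?N T g)"
    show "S \<inter> T \<subseteq> G" using S by blast
    show "\<forall>g\<in>S \<inter> T. ?N (S \<inter> T) g"
    proof
      fix g assume g: "g \<in> S \<inter> T"
      obtain B C where B: "finite B" "(\<lambda>h. g \<circ> h) ` pointwise_stabilizer U B \<subseteq> S"
        and C: "finite C" "(\<lambda>h. g \<circ> h) ` pointwise_stabilizer U C \<subseteq> T"
        using S T g by blast
      have "pointwise_stabilizer U (B \<union> C) \<subseteq> pointwise_stabilizer U B \<inter> pointwise_stabilizer U C"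
        by (auto simp: pointwise_stabilizer_def)
      then show "?N (S \<inter> T) g"
        using B C by (intro exI[of _ "B \<union> C"]) blast
    qed
  next
    fix K assume K: "\<forall>A\<in>K. A \<subseteq> G \<and> (\<forall>g\<in>A. ?N A g)"
    show "\<Union>K \<subseteq> G" using K by blast
    show "\<forall>g\<in>\<Union>K. ?N (\<Union>K) g"
    proof
      fix g assume "g \<in> \<Union>K"
      then obtain A where A: "A \<in> K" "g \<in> A" by blast
      have "?N A g" using bspec[OF conjunct2[OF bspec[OF K A(1)]] A(2)] .
      then show "?N (\<Union>K) g" using Union_upper[OF A(1)] by (meson subset_trans)
    qed
  qed
  then show ?thesis unfolding coset_topology_def by (simp only: topology_inverse')
qed

lemma openin_coset_topologyE:
  assumes "openin (coset_topology G U) A" "g \<in> A"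
  obtains B where "finite B" "\<And>u. u \<in> pointwise_stabilizer U B \<Longrightarrow> g \<circ> u \<in> A"
proof -
  have "\<exists>B. finite B \<and> (\<lambda>h. g \<circ> h) ` pointwise_stabilizer U B \<subseteq> A"
    by (rule bspec[OF conjunct2[OF assms(1)[unfolded openin_coset_topology]] assms(2)])
  then show thesis using that by (elim exE conjE) (simp add: image_subset_iff)
qed

lemma PiE_UNIV_agree:
  assumes "f \<in> PiE UNIV S"
  shows "PiE UNIV (\<lambda>x. if x \<in> B then {f x} else S x) = {h \<in> PiE UNIV S. \<forall>x\<in>B. h x = f x}"
proof (rule Set.set_eqI)
  fix h
  have "(h x \<in> (if x \<in> B then {f x} else S x)) \<longleftrightarrow> h x \<in> S x \<and> (x \<in> B \<longrightarrow> h x = f x)" for x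
    using assms by (auto simp: PiE_UNIV_domain Pi_iff)
  then show "h \<in> PiE UNIV (\<lambda>x. if x \<in> B then {f x} else S x) \<longleftrightarrow>
      h \<in> {h \<in> PiE UNIV S. \<forall>x\<in>B. h x = f x}"
    by (simp add: PiE_UNIV_domain Pi_iff) blast
qed

text \<open>The assumption \<open>commensurated\<close> is continuity at the identity of conjugation
  by elements of \<open>G\<close>. It is what turns the left-coset topology into a group
  topology.\<close>

locale commensurated_permutations = G: permutations G + U: permutations U
  for G U :: "('c \<Rightarrow> 'c) set" +
  assumes subset: "U \<subseteq> G"
    and commensurated: "g \<in> G \<Longrightarrow> finite B \<Longrightarrow> \<exists>C. finite C \<and>
      (\<forall>u\<in>pointwise_stabilizer U C. inv_into UNIV g \<circ> u \<circ> g \<in> pointwise_stabilizer U B)"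
begin

abbreviation "T \<equiv> coset_topology G U"

lemma openin_coset:
  assumes "g \<in> G" "finite B"
  shows "openin T ((\<lambda>h. g \<circ> h) ` pointwise_stabilizer U B)"
  unfolding openin_coset_topology
proof (intro conjI ballI)
  interpret S: permutations "pointwise_stabilizer U B" by (rule U.pointwise_stabilizer_permutations)
  show "(\<lambda>h. g \<circ> h) ` pointwise_stabilizer U B \<subseteq> G"
    using assms subset G.comp_closed by (auto simp: pointwise_stabilizer_def)
  fix x assume "x \<in> (\<lambda>h. g \<circ> h) ` pointwise_stabilizer U B"
  then obtain u where u: "u \<in> pointwise_stabilizer U B" "x = g \<circ> u" by blast
  have "(\<lambda>h. x \<circ> h) ` pointwise_stabilizer U B \<subseteq> (\<lambda>h. g \<circ> h) ` pointwise_stabilizer U B"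
    using S.comp_closed[OF u(1)] u(2) by (auto simp: comp_assoc)
  then show "\<exists>C. finite C \<and>
      (\<lambda>h. x \<circ> h) ` pointwise_stabilizer U C \<subseteq> (\<lambda>h. g \<circ> h) ` pointwise_stabilizer U B"
    using assms(2) by blast
qed

lemma coset_self: "g \<in> (\<lambda>h. g \<circ> h) ` pointwise_stabilizer U B"
  by (rule image_eqI[of _ _ id]) (auto simp: pointwise_stabilizer_def U.id_closed)

lemma topspace_coset_topology: "topspace T = G"
proof
  show "topspace T \<subseteq> G"
    using openin_topspace[of T] unfolding openin_coset_topology by blast
  have "openin T G"
    unfolding openin_coset_topology using subset G.comp_closed
    by (auto simp: pointwise_stabilizer_def intro!: exI[of _ "{}"])
  then show "G \<subseteq> topspace T" by (rule openin_subset)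
qed

text \<open>In group notation, \<open>(x u)(y v) = x y (y^-1 u y) v\<close> and
  \<open>(x u)^-1 = x^-1 (x u^-1 x^-1)\<close>; commensuration keeps the conjugated factors inside a
  prescribed stabilizer in \<open>U\<close>.\<close>

lemma topological_group_coset_topology: "topological_group (permutation_group G) T"
  unfolding topological_group_def
proof (intro conjI)
  show "continuous_map (prod_topology T T) T (\<lambda>(x, y). x \<otimes>\<^bsub>permutation_group G\<^esub> y)"
    unfolding continuous_map_def
  proof (intro conjI allI impI)
    show "(\<lambda>(x, y). x \<otimes>\<^bsub>permutation_group G\<^esub> y) \<in> topspace (prod_topology T T) \<rightarrow> topspace T"
      by (auto simp: topspace_coset_topology G.comp_closed)
    fix A assume A: "openin T A"
    show "openin (prod_topology T T)
      {z \<in> topspace (prod_topology T T). (case z of (x, y) \<Rightarrow> x \<otimes>\<^bsub>permutation_group G\<^esub> y) \<in> A}"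
      unfolding openin_prod_topology_alt
    proof (intro allI impI)
      fix x y assume "(x, y) \<in>
        {z \<in> topspace (prod_topology T T). (case z of (x, y) \<Rightarrow> x \<otimes>\<^bsub>permutation_group G\<^esub> y) \<in> A}"
      then have xy: "x \<in> G" "y \<in> G" "x \<circ> y \<in> A" by (auto simp: topspace_coset_topology)
      obtain B where B: "finite B" "\<And>u. u \<in> pointwise_stabilizer U B \<Longrightarrow> (x \<circ> y) \<circ> u \<in> A"
        using openin_coset_topologyE[OF A xy(3)] by blast
      obtain C where C: "finite C"
        "\<And>u. u \<in> pointwise_stabilizer U C \<Longrightarrow> inv_into UNIV y \<circ> u \<circ> y \<in> pointwise_stabilizer U B"
        using commensurated[OF xy(2) B(1)] by blast
      interpret S: permutations "pointwise_stabilizer U B"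
        by (rule U.pointwise_stabilizer_permutations)
      let ?V = "(\<lambda>h. x \<circ> h) ` pointwise_stabilizer U C"
      let ?W = "(\<lambda>h. y \<circ> h) ` pointwise_stabilizer U B"
      have open_VW: "openin T ?V" "openin T ?W" using openin_coset xy B(1) C(1) by blast+
      have "(x \<circ> u) \<circ> (y \<circ> v) \<in> A"
        if u: "u \<in> pointwise_stabilizer U C" and v: "v \<in> pointwise_stabilizer U B" for u v
      proof -
        have "(x \<circ> y) \<circ> ((inv_into UNIV y \<circ> u \<circ> y) \<circ> v) = x \<circ> (y \<circ> inv_into UNIV y) \<circ> u \<circ> y \<circ> v"
          by (simp only: comp_assoc)
        also have "\<dots> = (x \<circ> u) \<circ> (y \<circ> v)"
          by (simp only: G.comp_inv[OF xy(2)] comp_id comp_assoc)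
        finally show ?thesis using B(2)[OF S.comp_closed[OF C(2)[OF u] v]] by simp
      qed
      moreover have "?V \<subseteq> G" "?W \<subseteq> G"
        using open_VW[THEN openin_subset] by (simp_all add: topspace_coset_topology)
      ultimately have "?V \<times> ?W \<subseteq>
        {z \<in> topspace (prod_topology T T). (case z of (x, y) \<Rightarrow> x \<otimes>\<^bsub>permutation_group G\<^esub> y) \<in> A}"
        by (force simp: topspace_coset_topology)
      then show "\<exists>V W. openin T V \<and> openin T W \<and> x \<in> V \<and> y \<in> W \<and> V \<times> W \<subseteq>
        {z \<in> topspace (prod_topology T T). (case z of (x, y) \<Rightarrow> x \<otimes>\<^bsub>permutation_group G\<^esub> y) \<in> A}"
        using open_VW coset_self by (intro exI[of _ ?V] exI[of _ ?W] conjI)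
    qed
  qed
  show "continuous_map T T (\<lambda>x. inv\<^bsub>permutation_group G\<^esub> x)"
    unfolding continuous_map_def
  proof (intro conjI allI impI)
    show "(\<lambda>x. inv\<^bsub>permutation_group G\<^esub> x) \<in> topspace T \<rightarrow> topspace T"
      by (auto simp: topspace_coset_topology G.inv_closed)
    fix A assume A: "openin T A"
    show "openin T {x \<in> topspace T. inv\<^bsub>permutation_group G\<^esub> x \<in> A}"
      unfolding openin_coset_topology
    proof (intro conjI ballI)
      fix x assume "x \<in> {x \<in> topspace T. inv\<^bsub>permutation_group G\<^esub> x \<in> A}"
      then have x: "x \<in> G" "inv_into UNIV x \<in> A" by (auto simp: topspace_coset_topology)
      obtain B where B: "finite B" "\<And>u. u \<in> pointwise_stabilizer U B \<Longrightarrow> inv_into UNIV x \<circ> u \<in> A"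
        using openin_coset_topologyE[OF A x(2)] by blast
      obtain C where C: "finite C" "\<And>u. u \<in> pointwise_stabilizer U C \<Longrightarrow>
          inv_into UNIV (inv_into UNIV x) \<circ> u \<circ> inv_into UNIV x \<in> pointwise_stabilizer U B"
        using commensurated[OF G.inv_closed[OF x(1)] B(1)] by blast
      have "x \<circ> u \<in> {x \<in> topspace T. inv\<^bsub>permutation_group G\<^esub> x \<in> A}"
        if u: "u \<in> pointwise_stabilizer U C" for u
      proof -
        interpret S: permutations "pointwise_stabilizer U C"
          by (rule U.pointwise_stabilizer_permutations)
        have uU: "u \<in> G" "inv_into UNIV u \<in> G"
          using u S.inv_closed subset by (auto simp: pointwise_stabilizer_def)
        have "inv_into UNIV (x \<circ> u) = (inv_into UNIV x \<circ> x) \<circ> inv_into UNIV u \<circ> inv_into UNIV x"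
          by (simp only: G.inv_into_comp[OF x(1) uU(1)] G.inv_comp[OF x(1)] id_comp)
        also have "\<dots> = inv_into UNIV x \<circ>
            (inv_into UNIV (inv_into UNIV x) \<circ> inv_into UNIV u \<circ> inv_into UNIV x)"
          by (simp only: comp_assoc inv_inv_eq[OF G.bij[OF x(1)]])
        finally have "inv_into UNIV (x \<circ> u) \<in> A"
          using B(2)[OF C(2)[OF S.inv_closed[OF u]]] by simp
        then show ?thesis
          using G.comp_closed[OF x(1) uU(1)] by (simp add: topspace_coset_topology)
      qed
      then show "\<exists>B. finite B \<and> (\<lambda>h. x \<circ> h) ` pointwise_stabilizer U B \<subseteq>
          {x \<in> topspace T. inv\<^bsub>permutation_group G\<^esub> x \<in> A}"
        using C(1) by blast
    qed (auto simp: topspace_coset_topology)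
  qed
qed (simp_all add: G.group_permutation_group topspace_coset_topology)

lemma continuous_inclusion: "continuous_map (permutation_topology U) T (\<lambda>g. g)"
  unfolding continuous_map_def
proof (intro conjI allI impI)
  note U = U.topspace_permutation_topology
  show "(\<lambda>g. g) \<in> topspace (permutation_topology U) \<rightarrow> topspace T"
    using U subset by (auto simp: topspace_coset_topology)
  fix A assume A: "openin T A"
  show "openin (permutation_topology U) {x \<in> topspace (permutation_topology U). x \<in> A}"
    unfolding openin_permutation_topology U
  proof (intro conjI ballI)
    fix g assume g: "g \<in> {x \<in> U. x \<in> A}"
    then obtain B where "finite B" "\<And>u. u \<in> pointwise_stabilizer U B \<Longrightarrow> g \<circ> u \<in> A"
      using openin_coset_topologyE[OF A] by blast
    moreover have "g \<circ> u \<in> U" if "u \<in> pointwise_stabilizer U B" for u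
      using that g U.comp_closed by (simp add: pointwise_stabilizer_def)
    ultimately show "\<exists>B. finite B \<and> (\<lambda>h. g \<circ> h) ` pointwise_stabilizer U B \<subseteq> {x \<in> U. x \<in> A}"
      by (intro exI[of _ B]) auto
  qed blast
qed

lemma open_inclusion: "open_map (permutation_topology U) T (\<lambda>g. g)"
  using subset unfolding open_map_def openin_permutation_topology openin_coset_topology by auto

text \<open>Left translations are continuous for any group topology, so the topology is determined
  by the neighborhoods of \<open>id\<close>. Continuity and openness of the inclusion force these to
  be the ones coming from \<open>U\<close>.\<close>

lemma unique_group_topology:
  assumes "topological_group (permutation_group G) T'"
    and incl: "continuous_map (permutation_topology U) T' (\<lambda>g. g)"
    and op: "open_map (permutation_topology U) T' (\<lambda>g. g)"
  shows "T' = T"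
proof (rule topology_eq[THEN iffD2], intro allI iffI)
  have top: "topspace T' = G" and
    mult: "continuous_map (prod_topology T' T') T' (\<lambda>(x, y). x \<otimes>\<^bsub>permutation_group G\<^esub> y)"
    using assms(1) by (auto simp: topological_group_def)
  have trans: "openin T' {x \<in> G. g \<circ> x \<in> A}" if g: "g \<in> G" and A: "openin T' A" for g A
  proof -
    have "continuous_map T' (prod_topology T' T') (\<lambda>x. (g, x))"
      using g top by (intro continuous_map_pairedI) simp_all
    then have "continuous_map T' T' ((\<lambda>(x, y). x \<otimes>\<^bsub>permutation_group G\<^esub> y) \<circ> (\<lambda>x. (g, x)))"
      using mult by (rule continuous_map_compose)
    then have "openin T' {x \<in> G. g \<otimes>\<^bsub>permutation_group G\<^esub> x \<in> A}"
      using A top by (simp add: continuous_map_def)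
    moreover have "{x \<in> G. g \<otimes>\<^bsub>permutation_group G\<^esub> x \<in> A} = {x \<in> G. g \<circ> x \<in> A}"
      using g by auto
    ultimately show ?thesis by simp
  qed
  fix A
  show "openin T A" if A: "openin T' A"
    unfolding openin_coset_topology
  proof (intro conjI ballI)
    show AG: "A \<subseteq> G" using openin_subset[OF A] top by simp
    fix g assume g: "g \<in> A"
    then have gG: "g \<in> G" using AG by blast
    have "openin (permutation_topology U) {x \<in> topspace (permutation_topology U). x \<in> {x \<in> G. g \<circ> x \<in> A}}"
      using incl trans[OF gG A] unfolding continuous_map_def by blast
    moreover have "id \<in> topspace (permutation_topology U)"
      by (simp add: U.topspace_permutation_topology U.id_closed)
    ultimately obtain B where "finite B"
      "(\<lambda>h. id \<circ> h) ` pointwise_stabilizer U B \<subseteq> {x \<in> topspace (permutation_topology U). x \<in> {x \<in> G. g \<circ> x \<in> A}}"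
      using g G.id_closed unfolding openin_permutation_topology
      by (metis (mono_tags, lifting) comp_id mem_Collect_eq)
    then show "\<exists>B. finite B \<and> (\<lambda>h. g \<circ> h) ` pointwise_stabilizer U B \<subseteq> A"
      by (intro exI[of _ B]) auto
  qed
  show "openin T' A" if A: "openin T A"
  proof (subst openin_subopen, intro ballI)
    fix g assume g: "g \<in> A"
    obtain B where B: "finite B" "\<And>u. u \<in> pointwise_stabilizer U B \<Longrightarrow> g \<circ> u \<in> A"
      using openin_coset_topologyE[OF A g] by blast
    have gG: "g \<in> G" using g openin_subset[OF A] topspace_coset_topology by blast
    interpret S: permutations "pointwise_stabilizer U B"
      by (rule U.pointwise_stabilizer_permutations)
    have "openin (permutation_topology U) (pointwise_stabilizer U B)"
      unfolding openin_permutation_topology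
    proof (intro conjI ballI)
      show "pointwise_stabilizer U B \<subseteq> U" by (auto simp: pointwise_stabilizer_def)
      show "\<exists>C. finite C \<and> (\<lambda>h. x \<circ> h) ` pointwise_stabilizer U C \<subseteq> pointwise_stabilizer U B"
        if "x \<in> pointwise_stabilizer U B" for x
        using B(1) S.comp_closed[OF that] by (intro exI[of _ B]) blast
    qed
    then have "openin T' (pointwise_stabilizer U B)" using op unfolding open_map_def by simp
    then have "openin T' {x \<in> G. inv_into UNIV g \<circ> x \<in> pointwise_stabilizer U B}" (is "openin T' ?V")
      by (rule trans[OF G.inv_closed[OF gG]])
    moreover have "g \<in> ?V" using gG S.id_closed by (simp add: G.inv_comp)
    moreover have "?V \<subseteq> A"
    proof
      fix x assume "x \<in> ?V"
      then have "g \<circ> (inv_into UNIV g \<circ> x) \<in> A" using B(2) by simp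
      then show "x \<in> A" by (simp only: comp_assoc[symmetric] G.comp_inv[OF gG] id_comp)
    qed
    ultimately show "\<exists>V. openin T' V \<and> g \<in> V \<and> V \<subseteq> A" by blast
  qed
qed

text \<open>Replaces the definite description in \<open>restricted_universal_topology\<close> by a
  topology with explicit open sets.\<close>

lemma the_group_topology:
  "(THE T'. topological_group (permutation_group G) T' \<and>
     continuous_map (permutation_topology U) T' (\<lambda>g. g) \<and>
     open_map (permutation_topology U) T' (\<lambda>g. g)) = T"
  using topological_group_coset_topology continuous_inclusion open_inclusion unique_group_topology
  by (intro the_equality) blast+

text \<open>
  On \<open>K\<close> the topology is induced from the product of the finite discrete orbits, so that
  Tychonoff's theorem applies.
\<close>

lemma compactin_coset_topology:
  assumes K: "K \<subseteq> U" and orbits: "\<And>x. finite ((\<lambda>g. g x) ` K)"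
    and closed: "\<And>f. (\<And>B. finite B \<Longrightarrow> \<exists>g\<in>K. \<forall>x\<in>B. g x = f x) \<Longrightarrow> f \<in> K"
  shows "compactin T K"
proof -
  let ?S = "\<lambda>x. (\<lambda>g. g x) ` K"
  define X where "X = product_topology (\<lambda>x. discrete_topology (?S x)) UNIV"
  have top: "topspace X = PiE UNIV ?S" by (simp add: X_def)
  have compact: "compact_space X"
    using orbits by (simp add: X_def compact_space_product_topology compact_space_discrete_topology)
  have KX: "K \<subseteq> topspace X" by (auto simp: top)
  have open_agree: "openin X {h \<in> topspace X. \<forall>x\<in>B. h x = f x}" if "finite B" "f \<in> topspace X" for B f
  proof -
    let ?Y = "\<lambda>x. if x \<in> B then {f x} else ?S x"
    have "openin X (PiE UNIV ?Y)"
      unfolding X_def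
    proof (rule product_topology_basis)
      show "openin (discrete_topology (?S x)) (?Y x)" for x
        using that(2) by (auto simp: top)
      have "{x. ?Y x \<noteq> topspace (discrete_topology (?S x))} \<subseteq> B" by auto
      then show "finite {x. ?Y x \<noteq> topspace (discrete_topology (?S x))}"
        using that(1) finite_subset by blast
    qed
    moreover have "PiE UNIV ?Y = {h \<in> topspace X. \<forall>x\<in>B. h x = f x}"
      using that(2) unfolding top by (rule PiE_UNIV_agree)
    ultimately show ?thesis by simp
  qed
  have "closedin X K"
    unfolding closedin_def
  proof
    show "openin X (topspace X - K)"
    proof (subst openin_subopen, intro ballI)
      fix f assume f: "f \<in> topspace X - K"
      then obtain B where "finite B" "\<not> (\<exists>g\<in>K. \<forall>x\<in>B. g x = f x)" using closed by blast
      then show "\<exists>V. openin X V \<and> f \<in> V \<and> V \<subseteq> topspace X - K"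
        using f open_agree[of B f] by (intro exI[of _ "{h \<in> topspace X. \<forall>x\<in>B. h x = f x}"]) auto
    qed
  qed (rule KX)
  with compact have "compactin X K" by (rule closedin_compact_space)
  then have "compactin (subtopology X K) K" by (simp add: compactin_subtopology)
  moreover have "continuous_map (subtopology X K) T (\<lambda>g. g)"
    unfolding continuous_map_def
  proof (intro conjI allI impI)
    have topK: "topspace (subtopology X K) = K" using KX by auto
    show "(\<lambda>g. g) \<in> topspace (subtopology X K) \<rightarrow> topspace T"
      using topK K subset by (auto simp: topspace_coset_topology)
    fix A assume A: "openin T A"
    show "openin (subtopology X K) {x \<in> topspace (subtopology X K). x \<in> A}"
    proof (subst openin_subopen, intro ballI)
      fix g assume "g \<in> {x \<in> topspace (subtopology X K). x \<in> A}"
      then have g: "g \<in> K" "g \<in> A" using topK by auto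
      obtain B where B: "finite B" "\<And>u. u \<in> pointwise_stabilizer U B \<Longrightarrow> g \<circ> u \<in> A"
        using openin_coset_topologyE[OF A g(2)] by blast
      \<comment> \<open>An element of \<open>K\<close> that agrees with \<open>g\<close> on
        \<open>B\<close> differs from \<open>g\<close> by a right factor in the stabilizer of
        \<open>B\<close>, so this product neighborhood lies in a basic coset.\<close>
      let ?V = "{h \<in> topspace X. \<forall>x\<in>B. h x = g x} \<inter> K"
      have "openin (subtopology X K) ?V"
        using open_agree[OF B(1), of g] g(1) KX unfolding openin_subtopology by blast
      moreover have "h \<in> A" if h: "h \<in> ?V" for h
      proof -
        have U: "g \<in> U" "h \<in> U" using g h K by auto
        have "inv_into UNIV g \<circ> h \<in> pointwise_stabilizer U B"
          using h U.comp_closed[OF U.inv_closed[OF U(1)] U(2)] U.bij[OF U(1)]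
          by (auto simp: pointwise_stabilizer_def bij_is_inj)
        then have "g \<circ> (inv_into UNIV g \<circ> h) \<in> A" using B(2) by simp
        then show ?thesis by (simp only: comp_assoc[symmetric] U.comp_inv[OF U(1)] id_comp)
      qed
      ultimately show "\<exists>V. openin (subtopology X K) V \<and> g \<in> V \<and>
          V \<subseteq> {x \<in> topspace (subtopology X K). x \<in> A}"
        using g KX topK by (intro exI[of _ ?V]) blast
    qed
  qed
  ultimately have "compactin T ((\<lambda>g. g) ` K)" by (rule image_compactin)
  then show ?thesis by simp
qed

end

section \<open>The restricted universal group is compactly generated\<close>

lemma permutations_Int: "permutations G \<Longrightarrow> permutations H \<Longrightarrow> permutations (G \<inter> H)"
  by (simp add: permutations_def)

text \<open>Selects one witness for each element of \<open>A\<close> that has any. Finite generating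
  sets are obtained this way without deciding which requirements can be met.\<close>

lemma finite_witnesses:
  assumes "finite A"
  shows "\<exists>W. finite W \<and> W \<subseteq> B \<and> (\<forall>x\<in>A. (\<exists>t\<in>B. Q x t) \<longrightarrow> (\<exists>t\<in>W. Q x t))"
proof (intro exI conjI)
  let ?A = "{x \<in> A. \<exists>t\<in>B. Q x t}" and ?f = "\<lambda>x. SOME t. t \<in> B \<and> Q x t"
  have f: "?f x \<in> B \<and> Q x (?f x)" if "x \<in> ?A" for x
    using that by (intro someI_ex[of "\<lambda>t. t \<in> B \<and> Q x t"]) blast
  show "finite (?f ` ?A)" using assms by simp
  show "?f ` ?A \<subseteq> B" using f by blast
  show "\<forall>x\<in>A. (\<exists>t\<in>B. Q x t) \<longrightarrow> (\<exists>t\<in>?f ` ?A. Q x t)" using f by blast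
qed

lemma (in right_angled_building) finite_panel:
  assumes "locally_finite_semiregular I R q" "i \<in> I"
  shows "finite (R i `` {x})"
  using assms panel_in_panels unfolding locally_finite_semiregular_def by blast

context colored_building
begin

lemma universal_group_Aut: "g \<in> universal_group I R \<Omega> lam F \<Longrightarrow> g \<in> Aut"
  by (simp add: universal_group_def)

lemma Aut_inv_image: "g \<in> Aut \<Longrightarrow> g ` inv_into UNIV g ` P = P"
  using image_f_inv_f[OF bij_is_surj[OF Aut_bij]] .

lemma local_action_comp_closed:
  assumes "g \<in> Aut" "h \<in> Aut" "i \<in> I" "P \<in> panels R i" "subgroup H (BijGroup (\<Omega> i))"
    and "loc i g (h ` P) \<in> H" "loc i h P \<in> H"
  shows "loc i (g \<circ> h) P \<in> H"
  using local_action_comp[OF assms(1-4)] subgroup.m_closed[OF assms(5-7)] by simp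

lemma local_action_inv_closed:
  assumes g: "g \<in> Aut" and i: "i \<in> I" and P: "P \<in> panels R i"
    and H: "subgroup H (BijGroup (\<Omega> i))" and "loc i g (inv_into UNIV g ` P) \<in> H"
  shows "loc i (inv_into UNIV g) P \<in> H"
  using local_action_inv[OF g i Aut_panels[OF Aut_inv[OF g] i P]] subgroup.m_inv_closed[OF H assms(5)]
  by (simp add: Aut_inv_image[OF g])

lemma universal_group_permutations:
  assumes F: "local_data I \<Omega> F"
  shows "permutations (universal_group I R \<Omega> lam F)"
proof
  have sub: "i \<in> I \<Longrightarrow> subgroup (F i) (BijGroup (\<Omega> i))" for i
    using F by (simp add: local_data_def)
  show "id \<in> universal_group I R \<Omega> lam F"
    using subgroup.one_closed[OF sub] local_action_trivial[of _ _ id] Aut_id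
    by (auto simp: universal_group_def)
  fix g assume g: "g \<in> universal_group I R \<Omega> lam F"
  then have gA: "g \<in> Aut" by (rule universal_group_Aut)
  then show "bij g" by (rule Aut_bij)
  show "inv_into UNIV g \<in> universal_group I R \<Omega> lam F"
    unfolding universal_group_def
    using g Aut_inv[OF gA] local_action_inv_closed[OF gA _ _ sub] Aut_panels[OF Aut_inv[OF gA]]
    by (auto simp: universal_group_def)
  fix h assume h: "h \<in> universal_group I R \<Omega> lam F"
  then have hA: "h \<in> Aut" by (rule universal_group_Aut)
  show "g \<circ> h \<in> universal_group I R \<Omega> lam F"
    unfolding universal_group_def
    using g h Aut_comp[OF gA hA] local_action_comp_closed[OF gA hA _ _ sub] Aut_panels[OF hA]
    by (auto simp: universal_group_def)
qed

definition bad :: "('i \<Rightarrow> ('a \<Rightarrow> 'a) set) \<Rightarrow> 'i \<Rightarrow> ('c \<Rightarrow> 'c) \<Rightarrow> 'c set set" where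
  "bad F i g = {P \<in> panels R i. loc i g P \<notin> F i}"

lemma almost_universal_group_iff:
  "g \<in> almost_universal_group I R \<Omega> lam F \<longleftrightarrow> g \<in> Aut \<and> (\<forall>i\<in>I. finite (bad F i g))"
  by (simp add: almost_universal_group_def bad_def)

text \<open>A bad panel of \<open>g \<circ> h\<close> is bad for \<open>h\<close> or is carried by
  \<open>h\<close> to a bad panel of \<open>g\<close>; as \<open>h\<close> is injective on panels,
  there are finitely many of either kind.\<close>

lemma almost_universal_group_permutations:
  assumes F: "local_data I \<Omega> F"
  shows "permutations (almost_universal_group I R \<Omega> lam F)"
proof
  have sub: "i \<in> I \<Longrightarrow> subgroup (F i) (BijGroup (\<Omega> i))" for i
    using F by (simp add: local_data_def)
  have "bad F i id = {}" if "i \<in> I" for i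
    using subgroup.one_closed[OF sub[OF that]] local_action_trivial[OF that, of _ id]
    by (auto simp: bad_def)
  then show "id \<in> almost_universal_group I R \<Omega> lam F"
    using Aut_id by (simp add: almost_universal_group_iff)
  fix g assume g: "g \<in> almost_universal_group I R \<Omega> lam F"
  then have gA: "g \<in> Aut" and fin_g: "\<And>i. i \<in> I \<Longrightarrow> finite (bad F i g)"
    by (auto simp: almost_universal_group_iff)
  show "bij g" using gA by (rule Aut_bij)
  have "bad F i (inv_into UNIV g) \<subseteq> (`) g ` bad F i g" if i: "i \<in> I" for i
  proof
    fix P assume P: "P \<in> bad F i (inv_into UNIV g)"
    then have "inv_into UNIV g ` P \<in> bad F i g"
      using local_action_inv_closed[OF gA i _ sub[OF i], of P] Aut_panels[OF Aut_inv[OF gA] i]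
      by (auto simp: bad_def)
    then show "P \<in> (`) g ` bad F i g" using Aut_inv_image[OF gA, of P] by (metis image_eqI)
  qed
  then show "inv_into UNIV g \<in> almost_universal_group I R \<Omega> lam F"
    using Aut_inv[OF gA] fin_g by (simp add: almost_universal_group_iff) (meson finite_imageI finite_subset)
  fix h assume h: "h \<in> almost_universal_group I R \<Omega> lam F"
  then have hA: "h \<in> Aut" and fin_h: "\<And>i. i \<in> I \<Longrightarrow> finite (bad F i h)"
    by (auto simp: almost_universal_group_iff)
  have "inj ((`) h)" using Aut_bij[OF hA] by (intro injI) (simp add: inj_image_eq_iff bij_is_inj)
  moreover have "bad F i (g \<circ> h) \<subseteq> bad F i h \<union> (`) h -` bad F i g" if i: "i \<in> I" for i
    using local_action_comp_closed[OF gA hA i _ sub[OF i]] Aut_panels[OF hA i]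
    by (auto simp: bad_def)
  ultimately have "finite (bad F i (g \<circ> h))" if "i \<in> I" for i
    using that fin_g fin_h finite_vimageI by (meson finite_UnI finite_subset)
  then show "g \<circ> h \<in> almost_universal_group I R \<Omega> lam F"
    using Aut_comp[OF gA hA] by (simp add: almost_universal_group_iff)
qed

end

section \<open>The restricted universal group: topology, compact stabilizers and twists\<close>

locale restricted_universal_setting = colored_building I m R \<Omega> lam
  for I :: "'i set" and m :: "'i \<Rightarrow> 'i \<Rightarrow> enat" and R :: "'i \<Rightarrow> ('c \<times> 'c) set"
    and \<Omega> :: "'i \<Rightarrow> 'a set" and lam :: "'i \<Rightarrow> 'c \<Rightarrow> 'a" +
  fixes q :: "'i \<Rightarrow> nat" and F F' :: "'i \<Rightarrow> ('a \<Rightarrow> 'a) set"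
  assumes finite_I: "finite I"
    and locally_finite: "locally_finite_semiregular I R q"
    and finite_\<Omega>: "i \<in> I \<Longrightarrow> finite (\<Omega> i)"
    and F: "local_data I \<Omega> F" and F': "local_data I \<Omega> F'"
    and F_le: "i \<in> I \<Longrightarrow> F i \<subseteq> F' i" and F'_le: "i \<in> I \<Longrightarrow> F' i \<subseteq> young_overgroup (\<Omega> i) (F i)"
begin

abbreviation "U \<equiv> universal_group I R \<Omega> lam F"
abbreviation "G \<equiv> restricted_universal_group I R \<Omega> lam F F'"

lemma subgroup_F: "i \<in> I \<Longrightarrow> subgroup (F i) (BijGroup (\<Omega> i))"
  using F by (simp add: local_data_def)

lemma subgroup_F': "i \<in> I \<Longrightarrow> subgroup (F' i) (BijGroup (\<Omega> i))"
  using F' by (simp add: local_data_def)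

lemma one_F: "i \<in> I \<Longrightarrow> \<one>\<^bsub>BijGroup (\<Omega> i)\<^esub> \<in> F i"
  using subgroup_F subgroup.one_closed by blast

lemma F_Bij: "i \<in> I \<Longrightarrow> f \<in> F i \<Longrightarrow> f \<in> Bij (\<Omega> i)"
  using subgroup.subset[OF subgroup_F] by (auto simp: BijGroup_def)

lemma F'_Bij: "i \<in> I \<Longrightarrow> f \<in> F' i \<Longrightarrow> f \<in> Bij (\<Omega> i)"
  using subgroup.subset[OF subgroup_F'] by (auto simp: BijGroup_def)

lemma finite_F': "i \<in> I \<Longrightarrow> finite (F' i)"
proof (rule finite_subset)
  assume i: "i \<in> I"
  show "F' i \<subseteq> PiE (\<Omega> i) (\<lambda>_. \<Omega> i)"
  proof
    fix f assume "f \<in> F' i"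
    then have "f \<in> Bij (\<Omega> i)" by (rule F'_Bij[OF i])
    then show "f \<in> PiE (\<Omega> i) (\<lambda>_. \<Omega> i)"
      unfolding PiE_def by (intro IntI Bij_imp_extensional Bij_imp_funcset)
  qed
  show "finite (PiE (\<Omega> i) (\<lambda>_. \<Omega> i))" using finite_\<Omega>[OF i] by (intro finite_PiE) auto
qed

lemma G_iff:
  "g \<in> G \<longleftrightarrow> g \<in> Aut \<and> (\<forall>i\<in>I. finite (bad F i g)) \<and> (\<forall>i\<in>I. \<forall>P\<in>panels R i. loc i g P \<in> F' i)"
  by (auto simp: restricted_universal_group_def almost_universal_group_iff universal_group_def)

lemma U_iff: "g \<in> U \<longleftrightarrow> g \<in> Aut \<and> (\<forall>i\<in>I. \<forall>P\<in>panels R i. loc i g P \<in> F i)"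
  by (simp add: universal_group_def)

lemma U_iff_no_bad: "g \<in> U \<longleftrightarrow> g \<in> Aut \<and> (\<forall>i\<in>I. bad F i g = {})"
  by (auto simp: U_iff bad_def)

lemma U_subset_G: "U \<subseteq> G"
proof
  fix u assume u: "u \<in> U"
  then have "bad F i u = {}" if "i \<in> I" for i using that by (simp add: U_iff_no_bad)
  moreover have "loc i u P \<in> F' i" if "i \<in> I" "P \<in> panels R i" for i P
    using u F_le[OF that(1)] that by (auto simp: U_iff)
  ultimately show "u \<in> G" using u by (simp add: G_iff U_iff)
qed

lemma commensurated_permutations_U: "commensurated_permutations G U"
proof -
  have permG: "permutations G"
    unfolding restricted_universal_group_def
    by (rule permutations_Int[OF almost_universal_group_permutations[OF F]
          universal_group_permutations[OF F']])
  have permU: "permutations U" by (rule universal_group_permutations[OF F])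
  show ?thesis
  proof (rule commensurated_permutations.intro[OF permG permU], unfold_locales)
    show "U \<subseteq> G" by (rule U_subset_G)
    fix g B assume g: "g \<in> G" and B: "finite (B :: 'c set)"
    let ?C = "g ` B \<union> (\<Union>i\<in>I. \<Union>P\<in>bad F i g. g ` P)"
    have gA: "g \<in> Aut" using g by (simp add: G_iff)
    have "finite P" if "P \<in> bad F i g" "i \<in> I" for P i
      using that locally_finite by (auto simp: bad_def locally_finite_semiregular_def)
    then have "finite ?C" using B finite_I g by (auto simp: G_iff)
    moreover have "inv_into UNIV g \<circ> u \<circ> g \<in> pointwise_stabilizer U B"
      if u: "u \<in> pointwise_stabilizer U ?C" for u
    proof -
      let ?k = "inv_into UNIV g \<circ> u \<circ> g"
      have uU: "u \<in> U" and fix_u: "\<And>x. x \<in> ?C \<Longrightarrow> u x = x"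
        using u by (auto simp: pointwise_stabilizer_def)
      have uA: "u \<in> Aut" using uU by (rule universal_group_Aut)
      have kA: "?k \<in> Aut" using Aut_comp Aut_inv gA uA by blast
      have inv_g: "inv_into UNIV g (g x) = x" "g (inv_into UNIV g x) = x" for x
        using Aut_bij[OF gA] by (simp_all add: bij_is_inj bij_is_surj surj_f_inv_f)
      have fix_k: "?k x = x" if "u (g x) = g x" for x using that inv_g by simp
      have "loc i ?k P \<in> F i" if i: "i \<in> I" and P: "P \<in> panels R i" for i P
      proof (cases "P \<in> bad F i g")
        case True
        then have "?k x = x" if "x \<in> P" for x
          using that i fix_u[of "g x"] by (intro fix_k) blast
        then have "loc i ?k P = \<one>\<^bsub>BijGroup (\<Omega> i)\<^esub>"
          using local_action_trivial[OF i P, of ?k] by simp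
        then show ?thesis using one_F[OF i] by simp
      next
        case False
        \<comment> \<open>If the image were bad, \<open>u\<close> would fix \<open>u (g x)\<close>
          for each \<open>x\<close> in \<open>P\<close>, hence \<open>g x\<close> by injectivity.
          Then \<open>?k\<close> fixes \<open>P\<close> pointwise, and \<open>P\<close> itself would
          be bad.\<close>
        have "?k ` P \<notin> bad F i g"
        proof
          assume bad: "?k ` P \<in> bad F i g"
          have "?k x = x" if x: "x \<in> P" for x
          proof -
            have "g (?k x) \<in> ?C" using bad i x by blast
            then have "u (g (?k x)) = g (?k x)" by (rule fix_u)
            then have "u (u (g x)) = u (g x)" using inv_g by simp
            then have "u (g x) = g x" using Aut_bij[OF uA] by (metis bij_is_inj injD)
            then show ?thesis by (rule fix_k)
          qed
          then have "?k ` P = P" by (metis (no_types, lifting) image_cong image_ident)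
          with bad False show False by simp
        qed
        then have kP: "loc i g (?k ` P) \<in> F i"
          using Aut_panels[OF kA i P] by (simp add: bad_def)
        have guP: "u ` g ` P \<in> panels R i" using Aut_panels[OF _ i] uA gA P by blast
        have "inv_into UNIV g ` u ` g ` P = ?k ` P" by (simp add: image_comp)
        then have "loc i (inv_into UNIV g) (u ` g ` P) \<in> F i"
          using local_action_inv_closed[OF gA i guP subgroup_F[OF i]] kP by simp
        moreover have "loc i u (g ` P) \<in> F i"
          using uU Aut_panels[OF gA i P] i by (simp add: U_iff)
        ultimately have "loc i (inv_into UNIV g \<circ> u) (g ` P) \<in> F i"
          using local_action_comp_closed[OF Aut_inv[OF gA] uA i Aut_panels[OF gA i P] subgroup_F[OF i]]
          by simp
        moreover have "loc i g P \<in> F i" using False P by (simp add: bad_def)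
        ultimately show ?thesis
          by (rule local_action_comp_closed[OF Aut_comp[OF Aut_inv[OF gA] uA] gA i P subgroup_F[OF i]])
      qed
      then have "?k \<in> U" using kA by (simp add: U_iff)
      moreover have "?k x = x" if "x \<in> B" for x using that fix_u[of "g x"] by (intro fix_k) blast
      ultimately show ?thesis by (simp add: pointwise_stabilizer_def)
    qed
    ultimately show "\<exists>C. finite C \<and>
        (\<forall>u\<in>pointwise_stabilizer U C. inv_into UNIV g \<circ> u \<circ> g \<in> pointwise_stabilizer U B)"
      by blast
  qed
qed

sublocale commensurated_permutations G U
  by (rule commensurated_permutations_U)

text \<open>Orbits are finite by induction along galleries, since panels are finite. For closedness,
  preserving adjacency and having local actions in \<open>F\<close> are conditions on finitely many
  chambers at a time, so they pass to pointwise limits.\<close>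

lemma compactin_stabilizer: "compactin T (pointwise_stabilizer U {c})"
proof (rule compactin_coset_topology)
  let ?K = "pointwise_stabilizer U {c}"
  interpret K: permutations ?K by (rule U.pointwise_stabilizer_permutations)
  have K_Aut: "g \<in> Aut" if "g \<in> ?K" for g
    using that universal_group_Aut by (auto simp: pointwise_stabilizer_def)
  show "?K \<subseteq> U" by (auto simp: pointwise_stabilizer_def)
  show orbits: "finite ((\<lambda>g. g x) ` ?K)" for x
  proof (induction x rule: chamber_induct[where c = c])
    case base
    have "(\<lambda>g. g c) ` ?K \<subseteq> {c}" by (auto simp: pointwise_stabilizer_def)
    then show ?case using finite_subset by blast
  next
    case (step x y i)
    have "(\<lambda>g. g y) ` ?K \<subseteq> (\<Union>z\<in>(\<lambda>g. g x) ` ?K. R i `` {z})"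
      using Aut_R[OF K_Aut step(1), of _ x y] step by blast
    moreover have "finite (\<Union>z\<in>(\<lambda>g. g x) ` ?K. R i `` {z})"
      using step finite_panel[OF locally_finite] by blast
    ultimately show ?case by (rule finite_subset)
  qed
  fix f assume f: "\<And>B. finite B \<Longrightarrow> \<exists>g\<in>?K. \<forall>x\<in>B. g x = f x"
  have "inj f"
  proof (rule injI)
    fix x y assume eq: "f x = f y"
    obtain g where "g \<in> ?K" "g x = f x" "g y = f y" using f[of "{x, y}"] by auto
    then show "x = y" using eq K.bij by (metis bij_is_inj injD)
  qed
  moreover have "surj f"
  proof (rule surjI)
    fix y
    \<comment> \<open>Surjectivity of the limit needs the finite orbits: \<open>g\<close> is chosen
      to agree with \<open>f\<close> on the whole orbit of \<open>y\<close>, which contains the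
      preimage of \<open>y\<close> under \<open>g\<close>.\<close>
    obtain g where g: "g \<in> ?K" "\<forall>x\<in>(\<lambda>g. g y) ` ?K. g x = f x" using f[OF orbits] by blast
    have "inv_into UNIV g y \<in> (\<lambda>g. g y) ` ?K" using K.inv_closed[OF g(1)] by blast
    then have "f (inv_into UNIV g y) = g (inv_into UNIV g y)" using g(2) by metis
    also have "\<dots> = y" using K.bij[OF g(1)] by (simp add: bij_is_surj surj_f_inv_f)
    finally show "f (SOME z. f z = y) = y" by (rule someI)
  qed
  moreover have "(f x, f y) \<in> R i \<longleftrightarrow> (x, y) \<in> R i" if "i \<in> I" for i x y
  proof -
    obtain g where g: "g \<in> ?K" "g x = f x" "g y = f y" using f[of "{x, y}"] by auto
    show ?thesis using Aut_R[OF K_Aut[OF g(1)] that, of x y] g by simp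
  qed
  ultimately have fA: "f \<in> Aut" by (simp add: automorphism_iff bij_def)
  have "loc i f P \<in> F i" if i: "i \<in> I" and P: "P \<in> panels R i" for i P
  proof -
    obtain x where x: "P = R i `` {x}" using P panels_iff by blast
    then obtain g where g: "g \<in> ?K" "\<forall>y\<in>P. g y = f y"
      using f finite_panel[OF locally_finite i] by blast
    have "loc i f P = loc i g P"
      unfolding x
    proof (rule local_action_eqI[OF i])
      fix y assume y: "(x, y) \<in> R i"
      then show "lam i (f y) = loc i g (R i `` {x}) (lam i y)"
        using local_action_apply[OF i y] g(2) x by simp
    qed (simp add: local_action_def)
    then show ?thesis using g(1) i P by (simp add: pointwise_stabilizer_def U_iff)
  qed
  moreover have "f c = c" using f[of "{c}"] by (auto simp: pointwise_stabilizer_def)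
  ultimately show "f \<in> ?K" using fA by (simp add: pointwise_stabilizer_def U_iff)
qed

text \<open>Parallelism of an exceptional panel with that of \<open>c\<close> is recorded only
  through its consequence, the equality of local actions for all automorphisms.\<close>

definition twist :: "'i \<Rightarrow> 'c \<Rightarrow> ('a \<Rightarrow> 'a) \<Rightarrow> ('c \<Rightarrow> 'c) \<Rightarrow> bool" where
  "twist i c \<sigma> h \<longleftrightarrow> h \<in> Aut \<and> loc i h (R i `` {c}) = \<sigma> \<and>
     (\<forall>j\<in>I. \<forall>P\<in>panels R j. loc j h P \<in> F j \<or>
        j = i \<and> loc i h P = \<sigma> \<and> (\<forall>g\<in>Aut. loc i g P = loc i g (R i `` {c})))"

text \<open>The only place where the Young overgroup enters: since \<sigma> maps each orbit of
  \<open>F i\<close> onto itself, every color \<open>a\<close> admits some \<open>f a\<close> in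
  \<open>F i\<close> with \<open>f a a = \<sigma> a\<close>, as
  \<open>recoloring_automorphism\<close> requires.\<close>

lemma twist_exists:
  assumes i: "i \<in> I" and \<sigma>: "\<sigma> \<in> F' i"
  shows "\<exists>h. twist i c \<sigma> h"
proof -
  have "\<exists>f. f \<in> F i \<and> f a = \<sigma> a" if a: "a \<in> \<Omega> i" for a
  proof -
    let ?X = "{f a | f. f \<in> F i}"
    have X: "?X \<in> orbits (BijGroup (\<Omega> i)\<lparr>carrier := F i\<rparr>) (\<Omega> i) (\<lambda>h. h)"
      using a by (auto simp: orbits_def orbit_def)
    have "\<sigma> \<in> young_overgroup (\<Omega> i) (F i)" using F'_le[OF i] \<sigma> by (rule subsetD)
    then have "\<forall>X\<in>orbits (BijGroup (\<Omega> i)\<lparr>carrier := F i\<rparr>) (\<Omega> i) (\<lambda>h. h). \<sigma> ` X = X"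
      by (simp add: young_overgroup_def)
    then have "\<sigma> ` ?X = ?X" using X by (rule bspec)
    moreover have "\<one>\<^bsub>BijGroup (\<Omega> i)\<^esub> a = a" using a by (simp add: BijGroup_def)
    then have "a \<in> ?X"
      using one_F[OF i] by (intro CollectI exI[of _ "\<one>\<^bsub>BijGroup (\<Omega> i)\<^esub>"] conjI) simp_all
    ultimately have "\<sigma> a \<in> ?X" by blast
    then show ?thesis by auto
  qed
  then obtain f where f: "\<And>a. a \<in> \<Omega> i \<Longrightarrow> f a \<in> F i \<and> f a a = \<sigma> a" by metis
  obtain h where h: "h \<in> Aut" "loc i h (R i `` {c}) = \<sigma>"
    "\<forall>j\<in>I - {i}. \<forall>P\<in>panels R j. loc j h P = \<one>\<^bsub>BijGroup (\<Omega> j)\<^esub>"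
    "\<forall>P\<in>panels R i. (\<exists>a\<in>\<Omega> i. loc i h P = f a) \<or>
      loc i h P = \<sigma> \<and> (\<forall>g\<in>Aut. loc i g P = loc i g (R i `` {c}))"
    using recoloring_automorphism[OF i F'_Bij[OF i \<sigma>], of f c] F_Bij[OF i] f by blast
  have "loc j h P \<in> F j \<or>
      j = i \<and> loc i h P = \<sigma> \<and> (\<forall>g\<in>Aut. loc i g P = loc i g (R i `` {c}))"
    if "j \<in> I" "P \<in> panels R j" for j P
  proof (cases "j = i")
    case True
    then show ?thesis using h(4) that f by metis
  next
    case False
    then show ?thesis using h(3) that one_F by simp
  qed
  then show ?thesis using h(1,2) unfolding twist_def by blast
qed

text \<open>
  The exceptional panels of a twist realizing the local action of \<open>g\<close> at a bad panel are
  all bad for \<open>g\<close>: this gives finiteness even if the parallel class is a priori infinite.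
\<close>

lemma twist_in_G:
  assumes i: "i \<in> I" and g: "g \<in> G" and h: "twist i c (loc i g (R i `` {c})) h"
  shows "h \<in> G"
proof -
  have hA: "h \<in> Aut" using h by (simp add: twist_def)
  have cases: "loc j h P \<in> F j \<or> loc j h P = loc j g P" if "j \<in> I" "P \<in> panels R j" for j P
    using h that g unfolding twist_def G_iff by metis
  then have "bad F j h \<subseteq> bad F j g" if "j \<in> I" for j
    using that unfolding bad_def by fastforce
  then have "finite (bad F j h)" if "j \<in> I" for j
    using that g finite_subset[of "bad F j h" "bad F j g"] by (simp add: G_iff)
  moreover have "loc j h P \<in> F' j" if "j \<in> I" "P \<in> panels R j" for j P
    using cases[OF that] F_le[OF that(1)] g that by (auto simp: G_iff)
  ultimately show ?thesis using hA by (simp add: G_iff)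
qed

definition bad_count :: "('c \<Rightarrow> 'c) \<Rightarrow> nat" where
  "bad_count g = (\<Sum>j\<in>I. card (bad F j g))"

lemma Aut_inj_image: "h \<in> Aut \<Longrightarrow> inj_on ((`) h) X"
  using Aut_bij[of h] by (intro inj_onI) (simp add: inj_image_eq_iff bij_is_inj)

lemma bad_count_comp_U:
  assumes g: "g \<in> G" and u: "u \<in> U"
  shows "bad_count (g \<circ> u) \<le> bad_count g"
  unfolding bad_count_def
proof (rule sum_mono)
  fix j assume j: "j \<in> I"
  have gA: "g \<in> Aut" and uA: "u \<in> Aut" using g u by (auto simp: G_iff U_iff)
  have "(`) u ` bad F j (g \<circ> u) \<subseteq> bad F j g"
    using local_action_comp_closed[OF gA uA j _ subgroup_F[OF j]] u j Aut_panels[OF uA j]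
    by (auto simp: bad_def U_iff)
  then show "card (bad F j (g \<circ> u)) \<le> card (bad F j g)"
    using card_inj_on_le[OF Aut_inj_image[OF uA]] g j by (auto simp: G_iff)
qed

text \<open>The inverse of \<open>h\<close> maps bad panels of the quotient injectively to bad
  panels of \<open>g\<close>: off the exceptional panels of \<open>h\<close> it contributes a factor
  in \<open>F\<close>, and on them it cancels the local action of \<open>g\<close> completely. The
  panel of \<open>c\<close> is exceptional, hence missed by this map, and the count drops.\<close>

lemma bad_count_twist:
  assumes i: "i \<in> I" and g: "g \<in> G" and bad: "R i `` {c} \<in> bad F i g"
    and h: "twist i c (loc i g (R i `` {c})) h"
  shows "bad_count (g \<circ> inv_into UNIV h) < bad_count g"
proof -
  let ?h = "inv_into UNIV h" and ?P = "R i `` {c}"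
  have gA: "g \<in> Aut" and hA: "h \<in> Aut" using g h by (auto simp: G_iff twist_def)
  note h'A = Aut_inv[OF hA]
  have image: "?h ` Q \<in> bad F j g \<and> \<not> (j = i \<and> ?h ` Q = ?P)"
    if j: "j \<in> I" and Q: "Q \<in> bad F j (g \<circ> ?h)" for j Q
  proof -
    have QP: "Q \<in> panels R j" using Q by (simp add: bad_def)
    have P: "?h ` Q \<in> panels R j" by (rule Aut_panels[OF h'A j QP])
    show ?thesis
    proof (cases "loc j h (?h ` Q) \<in> F j")
      case True
      then have "loc j ?h Q \<in> F j"
        by (rule local_action_inv_closed[OF hA j QP subgroup_F[OF j]])
      then have "?h ` Q \<in> bad F j g"
        using Q P local_action_comp_closed[OF gA h'A j QP subgroup_F[OF j]] by (auto simp: bad_def)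
      moreover have "loc i h ?P \<notin> F i" using bad h by (simp add: bad_def twist_def)
      ultimately show ?thesis using True by auto
    next
      case False
      then have same: "j = i" "loc i h (?h ` Q) = loc i g (?h ` Q)"
        using h j P gA unfolding twist_def by metis+
      interpret B: group "BijGroup (\<Omega> i)" by (rule group_BijGroup)
      have "loc i (g \<circ> ?h) Q = loc i g (?h ` Q) \<otimes>\<^bsub>BijGroup (\<Omega> i)\<^esub> loc i ?h Q"
        using local_action_comp[OF gA h'A] j QP same(1) by simp
      also have "loc i ?h Q = inv\<^bsub>BijGroup (\<Omega> i)\<^esub> loc i h (?h ` Q)"
        using local_action_inv[OF hA i, of "?h ` Q"] P same(1) Aut_inv_image[OF hA, of Q] by simp
      also have "loc i g (?h ` Q) \<otimes>\<^bsub>BijGroup (\<Omega> i)\<^esub> inv\<^bsub>BijGroup (\<Omega> i)\<^esub> loc i h (?h ` Q)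
          = \<one>\<^bsub>BijGroup (\<Omega> i)\<^esub>"
        unfolding same(2) using local_action_Bij[OF gA i] P same(1)
        by (intro B.r_inv) (simp add: BijGroup_def)
      finally have "loc i (g \<circ> ?h) Q \<in> F i" by (simp only: one_F[OF i])
      then show ?thesis using Q same(1) unfolding bad_def by blast
    qed
  qed
  have fin: "finite (bad F j g)" if "j \<in> I" for j using g that by (simp add: G_iff)
  have le: "card (bad F j (g \<circ> ?h)) \<le> card (bad F j g)" if "j \<in> I" for j
  proof (rule card_inj_on_le[OF Aut_inj_image[OF h'A] _ fin[OF that]])
    show "(`) ?h ` bad F j (g \<circ> ?h) \<subseteq> bad F j g" using image[OF that] by blast
  qed
  have "card (bad F i (g \<circ> ?h)) \<le> card (bad F i g - {?P})"
  proof (rule card_inj_on_le[OF Aut_inj_image[OF h'A]])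
    show "(`) ?h ` bad F i (g \<circ> ?h) \<subseteq> bad F i g - {?P}" using image[OF i] by blast
    show "finite (bad F i g - {?P})" using fin[OF i] by simp
  qed
  also have "\<dots> < card (bad F i g)" using bad fin[OF i] by (rule card_Diff1_less[rotated])
  finally show ?thesis
    unfolding bad_count_def using i le by (intro sum_strict_mono_ex1[OF finite_I]) auto
qed

section \<open>Generation by a compact set\<close>

lemma color_preserving_U:
  assumes "\<And>i. i \<in> I \<Longrightarrow> lam i x = lam i y"
  shows "\<exists>u\<in>U. u x = y \<and> (\<forall>i\<in>I. \<forall>P\<in>panels R i. loc i u P = \<one>\<^bsub>BijGroup (\<Omega> i)\<^esub>)"
proof -
  obtain u where u: "u \<in> Aut" "u x = y" "\<forall>i\<in>I. \<forall>z. lam i (u z) = lam i z"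
    using color_automorphism_exists[OF legal legal assms] by blast
  then have "\<forall>i\<in>I. \<forall>P\<in>panels R i. loc i u P = \<one>\<^bsub>BijGroup (\<Omega> i)\<^esub>"
    using local_action_trivial by blast
  then show ?thesis using u(1,2) one_F by (intro bexI[of _ u]) (auto simp: U_iff)
qed

lemma finite_color_representatives:
  obtains D where "finite D" "\<And>x. \<exists>y\<in>D. \<forall>i\<in>I. lam i y = lam i x"
proof -
  let ?f = "\<lambda>x. \<lambda>i\<in>I. lam i x"
  have "range ?f \<subseteq> PiE I \<Omega>" using lam_in by auto
  moreover have "finite (PiE I \<Omega>)" using finite_I finite_\<Omega> by (intro finite_PiE) auto
  ultimately have "finite (range ?f)" by (rule finite_subset)
  then obtain D where D: "finite D" "range ?f = ?f ` D"
    using finite_subset_image[of "range ?f" ?f UNIV] by blast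
  have "\<exists>y\<in>D. \<forall>i\<in>I. lam i y = lam i x" for x
  proof -
    obtain y where y: "y \<in> D" "?f x = ?f y" using D(2) by blast
    have "lam i y = lam i x" if "i \<in> I" for i using fun_cong[OF y(2), of i] that by simp
    then show ?thesis using y(1) by blast
  qed
  with D(1) that show thesis by blast
qed

theorem compactly_generated_G: "compactly_generated (permutation_group G) T"
proof -
  obtain D where D: "finite D" "\<And>x. \<exists>y\<in>D. \<forall>i\<in>I. lam i y = lam i x"
    using finite_color_representatives by blast
  \<comment> \<open>An arbitrary base chamber; it may lie outside \<open>D\<close>, so it is added
    to form \<open>D'\<close>.\<close>
  define c :: 'c where "c = undefined"
  define D' where "D' = insert c D"
  \<comment> \<open>The representatives with all their neighbors: \<open>W1\<close> will realize
    every move of \<open>U\<close> between two chambers of this finite set.\<close>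
  define A where "A = D' \<union> (\<Union>i\<in>I. \<Union>x\<in>D'. R i `` {x})"
  \<comment> \<open>All possible data of a twist at a representative. This set is finite because
    each \<open>F' i\<close> is.\<close>
  define E where "E = (SIGMA i:I. D \<times> F' i)"
  have finD': "finite D'" using D(1) by (simp add: D'_def)
  then have "finite (A \<times> A)"
    using finite_I finite_panel[OF locally_finite] by (auto simp: A_def)
  then obtain W1 where W1: "finite W1" "W1 \<subseteq> U"
    "\<And>x y. x \<in> A \<Longrightarrow> y \<in> A \<Longrightarrow> \<exists>t\<in>U. t x = y \<Longrightarrow> \<exists>t\<in>W1. t x = y"
    using finite_witnesses[of "A \<times> A" U "\<lambda>p t. t (fst p) = snd p"] by force
  obtain W2 where W2: "finite W2" "W2 \<subseteq> U"
    "\<And>x. x \<in> D' \<Longrightarrow> \<exists>t\<in>U. t c = x \<Longrightarrow> \<exists>t\<in>W2. t c = x"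
    using finite_witnesses[OF finD', of U "\<lambda>x t. t c = x"] by force
  have "finite E" unfolding E_def using finite_I D(1) finite_F' by (intro finite_SigmaI) auto
  then obtain W3 where W3: "finite W3" "W3 \<subseteq> G"
    "\<And>i x \<sigma>. (i, x, \<sigma>) \<in> E \<Longrightarrow> \<exists>h\<in>G. twist i x \<sigma> h \<Longrightarrow> \<exists>h\<in>W3. twist i x \<sigma> h"
    using finite_witnesses[of E G "\<lambda>(i, x, \<sigma>) h. twist i x \<sigma> h"] by force
  define K where "K = pointwise_stabilizer U {c} \<union> (W1 \<union> W2 \<union> W3)"
  have stabU: "pointwise_stabilizer U {c} \<subseteq> U" by (auto simp: pointwise_stabilizer_def)
  have KG: "K \<subseteq> G"
    using stabU W1(2) W2(2) W3(2) U_subset_G by (auto simp: K_def)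
  have compact: "compactin T K"
    unfolding K_def
  proof (rule compactin_Un[OF compactin_stabilizer finite_imp_compactin])
    show "W1 \<union> W2 \<union> W3 \<subseteq> topspace T" using KG by (simp add: K_def topspace_coset_topology)
    show "finite (W1 \<union> W2 \<union> W3)" using W1(1) W2(1) W3(1) by simp
  qed
  let ?H = "generate (permutation_group G) K"
  have HG: "?H \<subseteq> G"
    using group.generate_in_carrier[OF G.group_permutation_group, of K] KG by auto
  have K_H: "g \<in> ?H" if "g \<in> K" for g using that by (rule generate.incl)
  have comp_H: "g \<circ> h \<in> ?H" if "g \<in> ?H" "h \<in> ?H" for g h
    using generate.eng[OF that] HG that by (simp add: subset_iff)
  have inv_H: "inv_into UNIV g \<in> ?H" if "g \<in> ?H" for g
    using group.generate_m_inv_closed[OF G.group_permutation_group, of K g] KG that HG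
    by (simp add: subset_iff)
  have id_H: "id \<in> ?H" using generate.one[of "permutation_group G" K] by simp
  have cancel_l: "g \<circ> (inv_into UNIV g \<circ> h) = h" if "g \<in> G" for g h :: "'c \<Rightarrow> 'c"
    by (simp only: comp_assoc[symmetric] G.comp_inv[OF that] id_comp)
  \<comment> \<open>If \<open>y\<close> is adjacent to \<open>\<gamma> a\<close>, pulling back by
    \<gamma> gives a neighbor \<open>a'\<close> of \<open>a\<close>, and \<open>W1\<close> contains
    an element taking a representative to \<open>a'\<close>. So the generated part of
    \<open>U\<close> reaches every chamber from \<open>D'\<close>.\<close>
  have transport: "\<exists>a\<in>D'. \<exists>\<gamma>. \<gamma> \<in> ?H \<and> \<gamma> \<in> U \<and> \<gamma> a = x" for x
  proof (induction x rule: chamber_induct[where c = c])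
    case base
    show ?case by (intro bexI[of _ c] exI[of _ id] conjI id_H U.id_closed) (simp_all add: D'_def)
  next
    case (step x y i)
    then obtain a \<gamma> where a: "a \<in> D'" and \<gamma>: "\<gamma> \<in> ?H" "\<gamma> \<in> U" "\<gamma> a = x" by blast
    have \<gamma>A: "\<gamma> \<in> Aut" using \<gamma>(2) by (rule universal_group_Aut)
    obtain a' where a': "\<gamma> a' = y" using Aut_bij[OF \<gamma>A] by (metis bij_pointE)
    then have "(a, a') \<in> R i" using Aut_R[OF \<gamma>A, of i a a'] \<gamma>(3) step by blast
    then have a'A: "a' \<in> A" using a step by (auto simp: A_def)
    obtain b where b: "b \<in> D" "\<forall>i\<in>I. lam i b = lam i a'" using D(2) by blast
    then have bA: "b \<in> A" by (simp add: A_def D'_def)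
    have "\<exists>t\<in>U. t b = a'" using color_preserving_U[of b a'] b(2) by blast
    then obtain t where t: "t \<in> W1" "t b = a'" using W1(3)[OF bA a'A] by blast
    have "\<gamma> \<circ> t \<in> ?H" using comp_H[OF \<gamma>(1) K_H] t(1) by (simp add: K_def)
    moreover have "\<gamma> \<circ> t \<in> U" using U.comp_closed \<gamma>(2) t(1) W1(2) by blast
    moreover have "(\<gamma> \<circ> t) b = y" using t(2) a' by simp
    moreover have "b \<in> D'" using b(1) by (simp add: D'_def)
    ultimately show ?case by blast
  qed
  have U_H: "u \<in> ?H" if u: "u \<in> U" for u
  proof -
    obtain a \<gamma> where a: "a \<in> D'" and \<gamma>: "\<gamma> \<in> ?H" "\<gamma> \<in> U" "\<gamma> a = u c"
      using transport[of "u c"] by blast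
    \<comment> \<open>Here \<open>u\<close> is factored as
      \<open>\<gamma> \<circ> s \<circ> k\<close>: \<gamma> comes from \<open>transport\<close>,
      \<open>s\<close> in \<open>W2\<close> takes \<open>c\<close> to \<open>a\<close>, and the
      remaining \<open>k\<close> fixes \<open>c\<close>.\<close>
    let ?v = "inv_into UNIV \<gamma> \<circ> u"
    have v: "?v \<in> U" using U.comp_closed[OF U.inv_closed[OF \<gamma>(2)] u] .
    have vc: "?v c = a" using \<gamma>(3) U.bij[OF \<gamma>(2)] by (simp add: bij_is_inj inv_f_eq)
    obtain s where s: "s \<in> W2" "s c = a" using W2(3)[OF a] v vc by blast
    have sU: "s \<in> U" using s(1) W2(2) by blast
    let ?k = "inv_into UNIV s \<circ> ?v"
    have "?k \<in> U" using U.comp_closed[OF U.inv_closed[OF sU] v] .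
    moreover have "?k c = c" using s(2) vc U.bij[OF sU] by (simp add: bij_is_inj inv_f_eq)
    ultimately have "?k \<in> ?H" by (intro K_H) (simp add: K_def pointwise_stabilizer_def)
    moreover have "s \<in> ?H" using s(1) by (intro K_H) (simp add: K_def)
    ultimately have "\<gamma> \<circ> (s \<circ> ?k) \<in> ?H" using comp_H \<gamma>(1) by blast
    then show ?thesis using cancel_l sU \<gamma>(2) U_subset_G by (simp add: subset_iff)
  qed
  have "g \<in> ?H" if "g \<in> G" for g
    using that
  proof (induction "bad_count g" arbitrary: g rule: less_induct)
    case less
    note g = less.prems
    have gA: "g \<in> Aut" using g by (simp add: G_iff)
    show ?case
    proof (cases "g \<in> U")
      case False
      then obtain i P where i: "i \<in> I" and P: "P \<in> bad F i g"
        using gA by (auto simp: U_iff_no_bad)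
      obtain x where x: "P = R i `` {x}" using P panels_iff by (auto simp: bad_def)
      obtain y where y: "y \<in> D" "\<forall>i\<in>I. lam i y = lam i x" using D(2) by blast
      \<comment> \<open>Precomposing with a color-preserving \<open>t\<close> moves the bad panel to
        a representative without changing the local action there, so twists at representatives
        suffice.\<close>
      obtain t where t: "t \<in> U" "t y = x"
        "\<forall>i\<in>I. \<forall>P\<in>panels R i. loc i t P = \<one>\<^bsub>BijGroup (\<Omega> i)\<^esub>"
        using color_preserving_U[of y x] y(2) by blast
      have tA: "t \<in> Aut" and tG: "t \<in> G" using t(1) U_subset_G by (auto simp: U_iff)
      define g1 where "g1 = g \<circ> t"
      let ?Py = "R i `` {y}"
      have g1: "g1 \<in> G" unfolding g1_def using g tG by (rule G.comp_closed)
      interpret B: group "BijGroup (\<Omega> i)" by (rule group_BijGroup)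
      have tP: "t ` ?Py = P" using Aut_image_panel[OF tA i] t(2) x by simp
      have "loc i g1 ?Py = loc i g P \<otimes>\<^bsub>BijGroup (\<Omega> i)\<^esub> \<one>\<^bsub>BijGroup (\<Omega> i)\<^esub>"
        unfolding g1_def using local_action_comp[OF gA tA i panel_in_panels] t(3) i panel_in_panels tP
        by simp
      also have "\<dots> = loc i g P"
        using local_action_Bij[OF gA i] P by (intro B.r_one) (simp add: bad_def BijGroup_def)
      finally have bad1: "?Py \<in> bad F i g1" using P by (simp add: bad_def panel_in_panels)
      let ?\<sigma> = "loc i g1 ?Py"
      have \<sigma>: "?\<sigma> \<in> F' i" using g1 i panel_in_panels by (simp add: G_iff)
      obtain h0 where "twist i y ?\<sigma> h0" using twist_exists[OF i \<sigma>] by blast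
      \<comment> \<open>\<open>W3\<close> offers a twist only for data that some element of
        \<open>G\<close> realizes; the bad panel of \<open>g1\<close> certifies this. The twist
        taken from \<open>W3\<close> may differ from \<open>h0\<close>, but any twist with these
        data lowers the count.\<close>
      then have "\<exists>h\<in>G. twist i y ?\<sigma> h" using twist_in_G[OF i g1] by blast
      moreover have "(i, y, ?\<sigma>) \<in> E" using i y(1) \<sigma> by (simp add: E_def)
      ultimately obtain h where h: "h \<in> W3" "twist i y ?\<sigma> h" using W3(3) by blast
      have hG: "h \<in> G" using h(1) W3(2) by blast
      have hH: "h \<in> ?H" using h(1) by (intro K_H) (simp add: K_def)
      let ?g2 = "g1 \<circ> inv_into UNIV h"
      have "bad_count ?g2 < bad_count g1" by (rule bad_count_twist[OF i g1 bad1 h(2)])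
      also have "\<dots> \<le> bad_count g" unfolding g1_def using g t(1) by (rule bad_count_comp_U)
      finally have "?g2 \<in> ?H" by (rule less.hyps) (rule G.comp_closed[OF g1 G.inv_closed[OF hG]])
      then have "(?g2 \<circ> h) \<circ> inv_into UNIV t \<in> ?H" using comp_H inv_H hH U_H[OF t(1)] by blast
      moreover have "(?g2 \<circ> h) \<circ> inv_into UNIV t = g"
      proof -
        have "(?g2 \<circ> h) \<circ> inv_into UNIV t = g \<circ> t \<circ> (inv_into UNIV h \<circ> h) \<circ> inv_into UNIV t"
          by (simp only: g1_def comp_assoc)
        also have "\<dots> = g \<circ> (t \<circ> inv_into UNIV t)"
          by (simp only: G.inv_comp[OF hG] comp_id comp_assoc)
        finally show ?thesis by (simp only: G.comp_inv[OF tG] comp_id)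
      qed
      ultimately show ?thesis by simp
    qed (rule U_H)
  qed
  then have "?H = carrier (permutation_group G)" using HG by auto
  then show ?thesis using compact unfolding compactly_generated_def by blast
qed

end

theorem corollary6p9:
  fixes I :: "'i set"
    and m :: "'i \<Rightarrow> 'i \<Rightarrow> enat"
    and R :: "'i \<Rightarrow> ('c \<times> 'c) set"
    and q :: "'i \<Rightarrow> nat"
    and \<Omega> :: "'i \<Rightarrow> 'a set"
    and lam :: "'i \<Rightarrow> 'c \<Rightarrow> 'a"
    and F F' :: "'i \<Rightarrow> ('a \<Rightarrow> 'a) set"
  assumes "finite I"
    and "right_angled I m"
    and "building I m R"
    and "locally_finite_semiregular I R q"
    and "\<forall>i\<in>I. finite (\<Omega> i) \<and> card (\<Omega> i) = q i"
    and "legal_coloring I R \<Omega> lam"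
    and "local_data I \<Omega> F"
    and "local_data I \<Omega> F'"
    and "\<forall>i\<in>I. F i \<subseteq> F' i \<and> F' i \<subseteq> young_overgroup (\<Omega> i) (F i)"
  shows "compactly_generated
           (permutation_group (restricted_universal_group I R \<Omega> lam F F'))
           (restricted_universal_topology I R \<Omega> lam F F')"
proof -
  interpret restricted_universal_setting I m R \<Omega> lam q F F'
    using assms by unfold_locales auto
  show ?thesis
    unfolding restricted_universal_topology_def the_group_topology by (rule compactly_generated_G)
qed

end
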